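(* For every $L\in\mathcal L_n$, the pair $(S,T)=\mathrm{fRSK}(L)$ is well-defined and lies in $\mathcal{FP}_n$, and $(\tau(S),\rho(T))=\mathrm{RSK}(L)$. That is, $(\tau\times\rho)\circ\mathrm{fRSK}$ equals the restriction of $\mathrm{RSK}$ to $\mathcal L_n\subset\mathcal M_n$.
   Context: Fix $n\ge1$, $[n]=\{1,\dots,n\}$. $\mathcal M_n$ is the set of $n\times n$ matrices with entries in $\mathbb N$ and $\mathcal L_n$ its subset of lower triangular matrices. A matrix $A$ corresponds to the biword (multiset of pairs $\binom ij$, $i,j\in[n]$, with $A_{ij}$ copies of $\binom ij$), written as $\binom{i_1\,\cdots\,i_\ell}{j_1\,\cdots\,j_\ell}$ with $i_k\le i_{k+1}$ and $j_k\ge j_{k+1}$ whenever $i_k=i_{k+1}$. For $A\in\mathcal L_n$ all $j_k\le i_k$. Cells $(c,r)$: column $c$, row $r$, row 1 at the bottom. For a partition $\lambda$, the (French) Ferrers diagram has $\lambda_r$ cells in row $r$, left justified. An SSYT is a filling of it with entries in $[n]$, rows weakly increasing left to right, columns strictly increasing bottom to top; a reverse SSYT has rows weakly decreasing left to right and columns strictly decreasing bottom to top. $\mathrm{SSYT}_n,\mathrm{rSSYT}_n$ denote these sets. $\mathcal P_n=\{(P,Q)\in\mathrm{rSSYT}_n\times\mathrm{SSYT}_n:\mathrm{sh}(P)=\mathrm{sh}(Q)\}$. Row insertion $P\leftarrow j$ for $P\in\mathrm{rSSYT}_n$: start with row $r=1$; place $j$ in the leftmost position of row $r$ that is empty or holds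 an entry strictly smaller than $j$, removing that entry $j'$ if present; if removed, repeat with $j'$ in row $r+1$. Then $(P,Q)\leftarrow\binom ij=(P\leftarrow j,Q')$ with $Q'$ obtained from $Q$ by adding the new cell of $P\leftarrow j$ with entry $i$; $\mathrm{RSK}(A)$ is obtained by successively inserting $\binom{i_1}{j_1},\dots,\binom{i_\ell}{j_\ell}$ starting from $(\emptyset,\emptyset)$. Key diagrams $\mathbb D(\mathbf a)=\{(c,r):1\le c\le\mathbf a_r\}$ for $\mathbf a\in\mathbb N^n$; a filling $T:\mathbb D(\mathbf a)\to[n]$ has shape $\mathbf a$ and weight $\mathrm{wt}(T)_i=|T^{-1}(i)|$; $\hat T$ adds basement cells $(0,r)$ with $\hat T(0,r)=r$, $r\in[n]$. Cells attack if in the same column or in adjacent columns with the left one strictly higher. Triples: three cells of $\hat T$ with distinct entries of the form $(c,r),(c+1,r),(c,s)$, $r<s$, $\mathbf a_r>\mathbf a_s$, or $(c+1,r),(c,s),(c+1,s)$, $r<s$, $\mathbf a_r\le\mathbf a_s$ ($c\ge 0$); with $k$ and $i$ the left and right entries in the common row and $j$ the third entry, it is a co-inversion triple if $i<j<k$, $j<k<i$ or $k<i<j$ and an inversion triple if $i>j>k$, $j>k>i$ or $k>i>j$. $\mathrm{SSKT}_n$: fillings with $\hat T$ non-attacking, rows of $\hat T$ weakly decreasing left to right, no co-inversion triples. $\mathrm{rSSAF}_n$: $\hat T$ non-attacking, rows of $\hat T$ weakly increasing left to right, no inversion triples. For $i\le n$, $\mathrm{SSKT}_i\subseteq\mathrm{SSKT}_n$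 etc. by appending zero parts. $\mathcal{FP}_n=\{(S,T)\in\mathrm{SSKT}_n\times\mathrm{rSSAF}_n:\mathrm{sh}(S)=\mathrm{sh}(T)\}$. $\rho(T)$ (for $T\in\mathrm{rSSAF}_n$) is the unique SSYT whose $c$th column has the same set of entries as column $c$ of $T$; $\tau(S)$ (for $S\in\mathrm{SSKT}_n$) is the unique reverse SSYT whose $c$th column has the same set of entries as column $c$ of $S$; $\tau\times\rho:(S,T)\mapsto(\tau(S),\rho(T))$. Flagged insertion $S\leftharpoondown_i j$ for $S\in\mathrm{SSKT}_i$, $j\in[i]$ (augmented with the $i$ basement cells $(0,1),\dots,(0,i)$, which are always taken into account): (1) set $c=\infty$; (2) let $c'\le c$ be the largest column index $\ge1$ such that column $c'$ contains strictly fewer entries weakly greater than $j$ than column $c'-1$; (3) among positions $(c',r)$ such that $(c'-1,r)$ holds an entry weakly greater than $j$ and $(c',r)$ is empty or holds an entry strictly smaller than $j$, take the topmost, place $j$ there and remove its previous entry $j'$ if any; (4) if $j'$ was removed, return to (2) with $c:=c'$, $j:=j'$. For a pair $\binom ij$ with $j\le i$, $(S,T)\leftharpoondown\binom ij=(S\leftharpoondown_i j,T')$ where $T'$ is $T$ with the cell $\mathbb D(\mathrm{sh}(S\leftharpoondown_ij))\setminus\mathbb D(\mathrm{sh}(S))$ added with entry $i$. $\mathrm{fRSK}(L)$ for $L\in\mathcal L_n$ is obtained by successively applying $\leftharpoondown\binom{i_1}{j_1},\dots,\leftharpoondown\binom{i_\ell}{j_\ell}$ to $(\emptyset,\emptyset)$.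 *)

theory Defs
  imports Main "HOL-Library.Extended_Nat"
begin

text \<open>
  Cells are pairs \<open>(c, r)\<close> (column, row), both counted from 1, with row 1 at the bottom.
  A filling is a partial map on cells, so shapes that differ only by trailing zero parts are
  identified and the inclusions between the sets for \<open>i \<le> n\<close> need no coercion.  An \<open>n \<times> n\<close>
  matrix over the naturals is a function on pairs of indices that vanishes outside
  \<open>{1..n} \<times> {1..n}\<close>, and an element of \<open>\<nat>\<^sup>n\<close> is a function vanishing outside \<open>{1..n}\<close>.
\<close>

type_synonym cell = "nat \<times> nat"
type_synonym filling = "cell \<Rightarrow> nat option"

section \<open>Matrices and biwords\<close>

definition matrices :: "nat \<Rightarrow> (nat \<Rightarrow> nat \<Rightarrow> nat) set" where
  "matrices n = {A. \<forall>i j. A i j \<noteq> 0 \<longrightarrow> i \<in> {1..n} \<and> j \<in> {1..n}}"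

definition lower_matrices :: "nat \<Rightarrow> (nat \<Rightarrow> nat \<Rightarrow> nat) set" where
  "lower_matrices n = {A \<in> matrices n. \<forall>i j. i < j \<longrightarrow> A i j = 0}"

definition biword :: "nat \<Rightarrow> (nat \<Rightarrow> nat \<Rightarrow> nat) \<Rightarrow> (nat \<times> nat) list" where
  "biword n A = concat [replicate (A i j) (i, j). i \<leftarrow> [1..<Suc n], j \<leftarrow> rev [1..<Suc n]]"

section \<open>Diagrams and tableaux\<close>

definition compositions :: "nat \<Rightarrow> (nat \<Rightarrow> nat) set" where
  "compositions n = {a. \<forall>r. a r \<noteq> 0 \<longrightarrow> r \<in> {1..n}}"

definition partitions :: "(nat \<Rightarrow> nat) set" where
  "partitions = {a. (\<exists>m. a \<in> compositions m) \<and> (\<forall>r s. 1 \<le> r \<and> r \<le> s \<longrightarrow> a s \<le> a r)}"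

definition diagram :: "(nat \<Rightarrow> nat) \<Rightarrow> cell set" where
  "diagram a = {(c, r). 1 \<le> c \<and> c \<le> a r}"

text \<open>
  For a filling of \<open>diagram a\<close> the following is \<open>a\<close>; the sets below all demand
  \<open>dom T = diagram (sh T)\<close>, which also excludes infinite rows.
\<close>

definition sh :: "filling \<Rightarrow> nat \<Rightarrow> nat" where
  "sh T r = card {c. (c, r) \<in> dom T}"

definition rows_weakly_increasing :: "filling \<Rightarrow> bool" where
  "rows_weakly_increasing F \<longleftrightarrow>
     (\<forall>c c' r x y. c < c' \<and> F (c, r) = Some x \<and> F (c', r) = Some y \<longrightarrow> x \<le> y)"

definition rows_weakly_decreasing :: "filling \<Rightarrow> bool" where
  "rows_weakly_decreasing F \<longleftrightarrow>
     (\<forall>c c' r x y. c < c' \<and> F (c, r) = Some x \<and> F (c', r) = Some y \<longrightarrow> y \<le> x)"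

definition columns_strictly_increasing :: "filling \<Rightarrow> bool" where
  "columns_strictly_increasing F \<longleftrightarrow>
     (\<forall>c r r' x y. r < r' \<and> F (c, r) = Some x \<and> F (c, r') = Some y \<longrightarrow> x < y)"

definition columns_strictly_decreasing :: "filling \<Rightarrow> bool" where
  "columns_strictly_decreasing F \<longleftrightarrow>
     (\<forall>c r r' x y. r < r' \<and> F (c, r) = Some x \<and> F (c, r') = Some y \<longrightarrow> y < x)"

definition SSYT :: "nat \<Rightarrow> filling set" where
  "SSYT n = {T. sh T \<in> partitions \<and> dom T = diagram (sh T) \<and> ran T \<subseteq> {1..n} \<and>
     rows_weakly_increasing T \<and> columns_strictly_increasing T}"

definition rSSYT :: "nat \<Rightarrow> filling set" where
  "rSSYT n = {T. sh T \<in> partitions \<and> dom T = diagram (sh T) \<and> ran T \<subseteq> {1..n} \<and>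
     rows_weakly_decreasing T \<and> columns_strictly_decreasing T}"

section \<open>Key tableaux and atom fillings\<close>

definition augment :: "nat \<Rightarrow> filling \<Rightarrow> filling" where
  "augment n T = (\<lambda>(c, r). if c = 0 then (if r \<in> {1..n} then Some r else None) else T (c, r))"

definition attack :: "cell \<Rightarrow> cell \<Rightarrow> bool" where
  "attack = (\<lambda>(c, r) (c', r'). (c = c' \<and> r \<noteq> r') \<or> (c' = Suc c \<and> r' < r) \<or> (c = Suc c' \<and> r < r'))"

definition non_attacking :: "filling \<Rightarrow> bool" where
  "non_attacking F \<longleftrightarrow> (\<forall>u v. u \<in> dom F \<and> v \<in> dom F \<and> attack u v \<longrightarrow> F u \<noteq> F v)"

text \<open>
  The entries \<open>(k, i, j)\<close> of the triples: \<open>k\<close> and \<open>i\<close> are the left and right entries in the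
  common row, \<open>j\<close> is the remaining one.
\<close>

definition triples :: "nat \<Rightarrow> filling \<Rightarrow> (nat \<times> nat \<times> nat) set" where
  "triples n T = {(k, i, j). k \<noteq> i \<and> i \<noteq> j \<and> j \<noteq> k \<and> (\<exists>c r s. 1 \<le> r \<and> r < s \<and> s \<le> n \<and>
     ((sh T r > sh T s \<and> augment n T (c, r) = Some k \<and> augment n T (Suc c, r) = Some i \<and>
         augment n T (c, s) = Some j) \<or>
      (sh T r \<le> sh T s \<and> augment n T (c, s) = Some k \<and> augment n T (Suc c, s) = Some i \<and>
         augment n T (Suc c, r) = Some j)))}"

definition coinversion_triple :: "nat \<times> nat \<times> nat \<Rightarrow> bool" where
  "coinversion_triple = (\<lambda>(k, i, j). (i < j \<and> j < k) \<or> (j < k \<and> k < i) \<or> (k < i \<and> i < j))"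

definition inversion_triple :: "nat \<times> nat \<times> nat \<Rightarrow> bool" where
  "inversion_triple = (\<lambda>(k, i, j). (i > j \<and> j > k) \<or> (j > k \<and> k > i) \<or> (k > i \<and> i > j))"

definition SSKT :: "nat \<Rightarrow> filling set" where
  "SSKT n = {S. sh S \<in> compositions n \<and> dom S = diagram (sh S) \<and> ran S \<subseteq> {1..n} \<and>
     non_attacking (augment n S) \<and> rows_weakly_decreasing (augment n S) \<and>
     (\<forall>t \<in> triples n S. \<not> coinversion_triple t)}"

definition rSSAF :: "nat \<Rightarrow> filling set" where
  "rSSAF n = {T. sh T \<in> compositions n \<and> dom T = diagram (sh T) \<and> ran T \<subseteq> {1..n} \<and>
     non_attacking (augment n T) \<and> rows_weakly_increasing (augment n T) \<and>
     (\<forall>t \<in> triples n T. \<not> inversion_triple t)}"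

definition FP :: "nat \<Rightarrow> (filling \<times> filling) set" where
  "FP n = {(S, T). S \<in> SSKT n \<and> T \<in> rSSAF n \<and> sh S = sh T}"

definition column_set :: "filling \<Rightarrow> nat \<Rightarrow> nat set" where
  "column_set T c = {x. \<exists>r. T (c, r) = Some x}"

definition \<rho> :: "nat \<Rightarrow> filling \<Rightarrow> filling" where
  "\<rho> n T = (THE Q. Q \<in> SSYT n \<and> (\<forall>c\<ge>1. column_set Q c = column_set T c))"

definition \<tau> :: "nat \<Rightarrow> filling \<Rightarrow> filling" where
  "\<tau> n S = (THE P. P \<in> rSSYT n \<and> (\<forall>c\<ge>1. column_set P c = column_set S c))"

section \<open>Row insertion and RSK\<close>

definition accepts :: "nat \<Rightarrow> nat option \<Rightarrow> bool" where
  "accepts j x = (case x of None \<Rightarrow> True | Some y \<Rightarrow> y < j)"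

text \<open>
  Insertion of \<open>j\<close> into row \<open>r\<close> and the rows above it.  A finite row always has an accepting
  position, and then the test \<open>j' < j\<close> succeeds; it is there only to make the recursion
  terminate on arbitrary partial maps.
\<close>

function row_insert_from :: "nat \<Rightarrow> filling \<Rightarrow> nat \<Rightarrow> filling" where
  "row_insert_from r P j =
     (let c = (LEAST c. 1 \<le> c \<and> accepts j (P (c, r)));
          P' = P((c, r) \<mapsto> j)
      in case P (c, r) of
           None \<Rightarrow> P'
         | Some j' \<Rightarrow> if j' < j then row_insert_from (Suc r) P' j' else undefined)"
  by pat_completeness auto
termination
  by (relation "Wellfounded.measure (\<lambda>(r, P, j). j)") auto

declare row_insert_from.simps [simp del]

definition row_insert :: "filling \<Rightarrow> nat \<Rightarrow> filling" where
  "row_insert P j = row_insert_from 1 P j"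

fun RSK_step :: "nat \<times> nat \<Rightarrow> filling \<times> filling \<Rightarrow> filling \<times> filling" where
  "RSK_step (i, j) (P, Q) =
     (let P' = row_insert P j in (P', Q(the_elem (dom P' - dom P) \<mapsto> i)))"

definition RSK :: "nat \<Rightarrow> (nat \<Rightarrow> nat \<Rightarrow> nat) \<Rightarrow> filling \<times> filling" where
  "RSK n A = fold RSK_step (biword n A) (Map.empty, Map.empty)"

section \<open>Flagged insertion and flagged RSK\<close>

text \<open>
  These operations return \<^term>\<open>None\<close> as soon as some step is not defined: the tableau is not
  in the required domain, the column or the position asked for does not exist, or the diagrams
  before and after an insertion do not differ by a single cell.
\<close>

definition count_ge :: "nat \<Rightarrow> filling \<Rightarrow> nat \<Rightarrow> nat \<Rightarrow> nat" where
  "count_ge i S j c = card {r. \<exists>x. augment i S (c, r) = Some x \<and> j \<le> x}"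

definition insertion_columns :: "nat \<Rightarrow> filling \<Rightarrow> enat \<Rightarrow> nat \<Rightarrow> nat set" where
  "insertion_columns i S c j =
     {c'. 1 \<le> c' \<and> enat c' \<le> c \<and> count_ge i S j c' < count_ge i S j (c' - 1)}"

definition insertion_rows :: "nat \<Rightarrow> filling \<Rightarrow> nat \<Rightarrow> nat \<Rightarrow> nat set" where
  "insertion_rows i S c j =
     {r. (\<exists>x. augment i S (c - 1, r) = Some x \<and> j \<le> x) \<and> accepts j (S (c, r))}"

definition largest :: "nat set \<Rightarrow> nat option" where
  "largest X = (if finite X \<and> X \<noteq> {} then Some (Max X) else None)"

lemma largest_in: "largest X = Some x \<Longrightarrow> x \<in> X"
  by (metis Max_in largest_def option.distinct(1) option.inject)

function flagged_insert_from :: "nat \<Rightarrow> enat \<Rightarrow> filling \<Rightarrow> nat \<Rightarrow> filling option" where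
  "flagged_insert_from i c S j =
     (case largest (insertion_columns i S c j) of
        None \<Rightarrow> None
      | Some c' \<Rightarrow>
          (case largest (insertion_rows i S c' j) of
             None \<Rightarrow> None
           | Some r \<Rightarrow>
               (case S (c', r) of
                  None \<Rightarrow> Some (S((c', r) \<mapsto> j))
                | Some j' \<Rightarrow> flagged_insert_from i (enat c') (S((c', r) \<mapsto> j)) j')))"
  by pat_completeness auto
termination
  by (relation "Wellfounded.measure (\<lambda>(i, c, S, j). j)")
     (auto dest!: largest_in simp: insertion_rows_def accepts_def)

declare flagged_insert_from.simps [simp del]

definition flagged_insert :: "nat \<Rightarrow> filling \<Rightarrow> nat \<Rightarrow> filling option" where
  "flagged_insert i S j =
     (if S \<in> SSKT i \<and> j \<in> {1..i} then flagged_insert_from i \<infinity> S j else None)"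

fun fRSK_step :: "nat \<times> nat \<Rightarrow> filling \<times> filling \<Rightarrow> (filling \<times> filling) option" where
  "fRSK_step (i, j) (S, T) =
     (case flagged_insert i S j of
        None \<Rightarrow> None
      | Some S' \<Rightarrow>
          (let X = diagram (sh S') - diagram (sh S)
           in if is_singleton X then Some (S', T(the_elem X \<mapsto> i)) else None))"

definition fRSK :: "nat \<Rightarrow> (nat \<Rightarrow> nat \<Rightarrow> nat) \<Rightarrow> (filling \<times> filling) option" where
  "fRSK n L = fold (\<lambda>p X. Option.bind X (fRSK_step p)) (biword n L) (Some (Map.empty, Map.empty))"

end

theory Submission
  imports Defs
begin

text \<open>
  Code a filling by numbers \<open>G c r\<close>, with 0 for an empty cell and column 0 the basement.  With
  respect to this coding the triple conditions become local: they only compare two rows in two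
  adjacent columns and no longer mention the shape.  In this form it is easy to see that each
  replacement of the flagged insertion stays inside the key tableaux, and that the new cell lies
  in the topmost available row of its column, which is what the recording filling needs.

  Both insertions change the column sets in the same way.  Row insertion into row \<open>r\<close> of a reverse
  tableau acts on the leftmost column with fewer than \<open>r\<close> entries that are at least \<open>j\<close>, and this is
  the last column up to the current one where the number of such entries drops.  A flagged replacement
  of \<open>z\<close> by \<open>j\<close> amounts to several row insertion steps that bump, within one column, the entries
  between \<open>j\<close> and \<open>z\<close> one after the other.  Finally (reverse) semistandard tableaux are determined
  by their column sets.
\<close>

section \<open>Local form of the triple conditions\<close>

text \<open>The type of a triple depends on which of its two rows is longer, and one new cell can
  reverse this for all columns of the two rows at once, so the original conditions cannot be
  followed entry by entry. The local conditions propagate from left to right and force the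
  comparison of lengths: if the lower of two rows has the larger entry in a column that both rows
  reach, it ends up strictly longer in a key filling and at most as long in an atom filling. The
  induction therefore carries the local form from the empty filling on.

  Membership and agreement with RSK are proved together. For the recording filling, equal letters
  must enter columns further and further to the right, and this comes from the RSK side, by the row
  bumping lemma for reverse tableaux. The two shapes differ, but column by column they have the same
  height, so the two new cells share their column.

  An insertion column exists by counting: the basement has \<open>n - j + 1\<close> entries that are
  at least \<open>j\<close>, while a column that avoids \<open>j\<close> has at most
  \<open>n - j\<close>.\<close>

definition basement :: "nat \<Rightarrow> nat \<Rightarrow> nat" where
  "basement n r = (if 1 \<le> r \<and> r \<le> n then r else 0)"

text \<open>Column 0 is dropped because \<open>augment\<close> supplies the basement; a change of
  basement thus leaves the filling as it is.\<close>

definition filling_of :: "(nat \<Rightarrow> nat \<Rightarrow> nat) \<Rightarrow> filling" where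
  "filling_of G = (\<lambda>(c, r). if c = 0 \<or> G c r = 0 then None else Some (G c r))"

lemma filling_of_eq_Some: "filling_of G (c, r) = Some x \<longleftrightarrow> 1 \<le> c \<and> 0 < x \<and> G c r = x"
  by (auto simp: filling_of_def)

lemma filling_of_eq_None: "filling_of G (c, r) = None \<longleftrightarrow> c = 0 \<or> G c r = 0"
  by (auto simp: filling_of_def)

lemma mem_dom_filling_of: "(c, r) \<in> dom (filling_of G) \<longleftrightarrow> 1 \<le> c \<and> 0 < G c r"
  by (auto simp: filling_of_def dom_def)

text \<open>What key and atom fillings share. \<open>base\<close> and \<open>left_pos\<close>
  confine the support to left-justified rows among 1 to \<open>n\<close>, \<open>bounded\<close>
  makes these rows finite, and \<open>col_inj\<close> is the part of non-attacking that concerns a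
  single column; its positivity guard lets empty cells repeat.\<close>

locale skyline =
  fixes n :: nat and G :: "nat \<Rightarrow> nat \<Rightarrow> nat"
  assumes base: "G 0 = basement n"
    and left_pos: "\<And>c r. 0 < G (Suc c) r \<Longrightarrow> 0 < G c r"
    and bounded: "\<exists>M. \<forall>r. G M r = 0"
    and col_inj: "\<And>c r s. G c r = G c s \<Longrightarrow> 0 < G c r \<Longrightarrow> r = s"
    and le: "\<And>c r. G c r \<le> n"
begin

lemma pos_mono: "0 < G d r \<Longrightarrow> c \<le> d \<Longrightarrow> 0 < G c r"
proof (induction d)
  case (Suc d)
  then show ?case using left_pos[of d r] by (cases "c = Suc d") auto
qed simp

lemma row_range: "0 < G c r \<Longrightarrow> 1 \<le> r \<and> r \<le> n"
  using pos_mono[of c r 0] by (auto simp: base basement_def split: if_splits)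

lemma finite_rows: "finite {r. 0 < G c r}"
  by (rule finite_subset[of _ "{1..n}"]) (use row_range in auto)

lemma finite_ge: "0 < j \<Longrightarrow> finite {r. j \<le> G c r}"
  by (rule finite_subset[OF _ finite_rows[of c]]) auto

lemma augment_filling_of:
  "augment n (filling_of G) (c, r) = Some x \<longleftrightarrow> 0 < x \<and> G c r = x"
  by (auto simp: augment_def filling_of_def base basement_def)

lemma finite_row: "finite {c. 1 \<le> c \<and> 0 < G c r}"
proof -
  obtain M where "\<forall>r. G M r = 0" using bounded by blast
  then have "{c. 1 \<le> c \<and> 0 < G c r} \<subseteq> {..M}"
    using pos_mono[of _ r M] by (metis (mono_tags, lifting) atMost_iff mem_Collect_eq nat_le_linear
        not_gr_zero subsetI)
  then show ?thesis by (rule finite_subset) simp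
qed

text \<open>The positive cells of a row form an initial segment, so the cardinality defining
  \<open>sh\<close> is also the index of the last nonempty column.\<close>

lemma le_sh_iff: "1 \<le> c \<Longrightarrow> c \<le> sh (filling_of G) r \<longleftrightarrow> 0 < G c r"
proof -
  let ?A = "{c. 1 \<le> c \<and> 0 < G c r}"
  assume c: "1 \<le> c"
  have sh: "sh (filling_of G) r = card ?A" by (simp add: sh_def mem_dom_filling_of)
  show ?thesis
  proof
    assume "0 < G c r"
    then have "{1..c} \<subseteq> ?A" using pos_mono[of c r] by auto
    then show "c \<le> sh (filling_of G) r" using card_mono[OF finite_row[of r]] sh by (metis card_atLeastAtMost diff_Suc_1)
  next
    assume le: "c \<le> sh (filling_of G) r"
    show "0 < G c r"
    proof (rule ccontr)
      assume "\<not> 0 < G c r"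
      then have "d < c" if "0 < G d r" for d using pos_mono[OF that, of c] by linarith
      then have "?A \<subseteq> {1..<c}" by auto
      then have "card ?A \<le> c - 1" using card_mono[of "{1..<c}" ?A] by simp
      then show False using le sh c by simp
    qed
  qed
qed

lemma dom_filling_of: "dom (filling_of G) = diagram (sh (filling_of G))"
proof (rule set_eqI)
  fix u :: cell
  obtain c r where u: "u = (c, r)" by (cases u)
  show "u \<in> dom (filling_of G) \<longleftrightarrow> u \<in> diagram (sh (filling_of G))"
    unfolding u mem_dom_filling_of using le_sh_iff[of c r] by (auto simp: diagram_def)
qed

lemma sh_compositions: "sh (filling_of G) \<in> compositions n"
  unfolding compositions_def
proof (rule CollectI, intro allI impI)
  fix r assume "sh (filling_of G) r \<noteq> 0"
  then have "0 < G 1 r" using le_sh_iff[of 1 r] by simp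
  then show "r \<in> {1..n}" using row_range[of 1 r] by simp
qed

lemma ran_filling_of: "x \<in> ran (filling_of G) \<Longrightarrow> 1 \<le> x \<and> x \<le> n"
  using le by (auto simp: ran_def filling_of_def split: if_splits)

lemma column_set_filling_of: "1 \<le> c \<Longrightarrow> column_set (filling_of G) c = G c ` {r. 0 < G c r}"
  by (auto simp: column_set_def filling_of_eq_Some)

end

lemma non_attackingI:
  assumes "\<And>c r s x. F (c, r) = Some x \<Longrightarrow> F (c, s) = Some x \<Longrightarrow> r = s"
    and "\<And>c r s x. r < s \<Longrightarrow> F (c, s) = Some x \<Longrightarrow> F (Suc c, r) = Some x \<Longrightarrow> False"
  shows "non_attacking F"
proof -
  have F: False if att: "attack u v" and F: "F u = Some x" "F v = Some x" for u v x
  proof -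
    obtain c r c' s where [simp]: "u = (c, r)" "v = (c', s)" by (cases u, cases v)
    consider "c = c'" "r \<noteq> s" | "c' = Suc c" "s < r" | "c = Suc c'" "r < s"
      using att by (auto simp: attack_def)
    then show False
      using F assms(1)[of c r x s] assms(2)[of s r c x] assms(2)[of r s c' x]
      by cases simp_all
  qed
  show ?thesis
    unfolding non_attacking_def
  proof (intro allI impI notI)
    fix u v
    assume *: "u \<in> dom F \<and> v \<in> dom F \<and> attack u v" "F u = F v"
    then obtain x where "F u = Some x" by blast
    with * F show False by metis
  qed
qed

text \<open>
  Row \<open>r\<close> starts in the basement with a smaller entry than row \<open>s > r\<close>; assumption \<open>key\<close> says that once \<open>r\<close> has overtaken \<open>s\<close> it stays ahead by a full column, so that row \<open>r\<close> is the longer one.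
\<close>

locale key_skyline = skyline +
  assumes row: "\<And>c r. G (Suc c) r \<le> G c r"
    and key: "\<And>c r s. r < s \<Longrightarrow> G c s < G c r \<Longrightarrow> 0 < G c s \<Longrightarrow> G c s < G (Suc c) r"
begin

lemma row_mono: "c \<le> d \<Longrightarrow> G d r \<le> G c r"
  using row by (rule lift_Suc_antimono_le)

text \<open>\<open>key\<close> puts a larger entry of row \<open>r\<close> one column further right.
  Since row \<open>s\<close> weakly decreases, the hypothesis holds again there as long as row
  \<open>s\<close> lasts; at the last column of row \<open>s\<close> this leaves one more cell in
  row \<open>r\<close>.\<close>

lemma overtaken:
  assumes "r < s" "G c s < G c r" "0 < G c s"
  shows "sh (filling_of G) s < sh (filling_of G) r"
proof -
  let ?e = "sh (filling_of G) s"
  have *: "0 < G e s \<longrightarrow> G e s < G (Suc e) r" if "c \<le> e" for e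
    using that
  proof (induction e rule: dec_induct)
    case base
    then show ?case using key assms by blast
  next
    case (step e)
    then show ?case using left_pos[of e s] row[of e s] key[of r s "Suc e"] assms(1) by fastforce
  qed
  have e: "c \<le> ?e \<and> 0 < G ?e s"
  proof (cases "c = 0")
    case True
    then show ?thesis using assms(3) le_sh_iff[of ?e s] by (cases "?e = 0") auto
  next
    case False
    then have "c \<le> ?e" using le_sh_iff[of c s] assms(3) by simp
    then show ?thesis using False le_sh_iff[of ?e s] by simp
  qed
  then have "0 < G (Suc ?e) r" using * by fastforce
  then show ?thesis using le_sh_iff[of "Suc ?e" r] by simp
qed

text \<open>In weakly decreasing rows a co-inversion triple must satisfy \<open>i < j < k\<close>.
  For the type with two cells in column \<open>c\<close> this contradicts \<open>key\<close>,
  whatever the shape. For the other type it says that row \<open>r\<close> is ahead of row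
  \<open>s\<close> in column \<open>Suc c\<close>, and \<open>overtaken\<close> refutes the
  condition on the lengths.\<close>

theorem SSKT: "filling_of G \<in> SSKT n"
proof -
  have "non_attacking (augment n (filling_of G))"
  proof (rule non_attackingI)
    fix c r s x
    assume "augment n (filling_of G) (c, r) = Some x" "augment n (filling_of G) (c, s) = Some x"
    then show "r = s" using col_inj[of c r s] by (auto simp: augment_filling_of)
  next
    fix c r s x
    assume rs: "r < s" and "augment n (filling_of G) (c, s) = Some x"
      "augment n (filling_of G) (Suc c, r) = Some x"
    then have "0 < G c s" "G (Suc c) r = G c s" by (auto simp: augment_filling_of)
    then show False using key[OF rs, of c] row[of c r] col_inj[of c r s] rs by fastforce
  qed
  moreover have "rows_weakly_decreasing (augment n (filling_of G))"
    unfolding rows_weakly_decreasing_def using row_mono by (auto simp: augment_filling_of)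
  moreover have "\<not> coinversion_triple t" if "t \<in> triples n (filling_of G)" for t
  proof
    obtain k i j where t: "t = (k, i, j)" by (cases t)
    assume "coinversion_triple t"
    then have co: "(i < j \<and> j < k) \<or> (j < k \<and> k < i) \<or> (k < i \<and> i < j)"
      by (simp add: t coinversion_triple_def)
    from that t obtain c r s where rs: "r < s" and
      "(G c r = k \<and> G (Suc c) r = i \<and> G c s = j \<and> 0 < j) \<or>
       (sh (filling_of G) r \<le> sh (filling_of G) s \<and> G c s = k \<and> G (Suc c) s = i \<and> 0 < i \<and> G (Suc c) r = j)"
      by (auto simp: triples_def augment_filling_of)
    then show False
    proof (elim disjE conjE)
      assume "G c r = k" "G (Suc c) r = i" "G c s = j" "0 < j"
      then show False using co row[of c r] key[OF rs, of c] by auto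
    next
      assume "sh (filling_of G) r \<le> sh (filling_of G) s" "G c s = k" "G (Suc c) s = i" "0 < i" "G (Suc c) r = j"
      then show False using co row[of c s] overtaken[OF rs, of "Suc c"] by auto
    qed
  qed
  ultimately show ?thesis
    using ran_filling_of by (auto simp: SSKT_def sh_compositions simp flip: dom_filling_of)
qed

end

text \<open>Rows now increase. Once the lower row \<open>r\<close> has the larger entry, the first
  alternative of \<open>atom\<close> is impossible in all later columns, so row \<open>s\<close> has
  to keep pace with row \<open>r\<close> by smaller entries. Equality of the two diagonal entries,
  an attack, is excluded by either alternative together with \<open>row\<close>.\<close>

locale atom_skyline = skyline +
  assumes row: "\<And>c r. 0 < G (Suc c) r \<Longrightarrow> G c r \<le> G (Suc c) r"
    and atom: "\<And>c r s. r < s \<Longrightarrow> 0 < G c s \<Longrightarrow> 0 < G (Suc c) r \<Longrightarrow>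
      G (Suc c) r < G c s \<or> (0 < G (Suc c) s \<and> G (Suc c) s < G (Suc c) r)"
begin

lemma row_mono: "c \<le> d \<Longrightarrow> 0 < G d r \<Longrightarrow> G c r \<le> G d r"
proof (induction d)
  case (Suc d)
  then show ?case using left_pos[of d r] row[of d r] by (cases "c = Suc d") auto
qed simp

lemma overtaken:
  assumes "r < s" "G c s < G c r" "0 < G c s"
  shows "sh (filling_of G) r \<le> sh (filling_of G) s"
proof -
  let ?e = "sh (filling_of G) r"
  have *: "0 < G e r \<longrightarrow> 0 < G e s \<and> G e s < G e r" if "c \<le> e" for e
    using that
  proof (induction e rule: dec_induct)
    case base
    then show ?case using assms by blast
  next
    case (step e)
    show ?case
    proof
      assume pos: "0 < G (Suc e) r"
      then have "0 < G e s \<and> G e s < G e r" using step left_pos[of e r] by simp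
      then show "0 < G (Suc e) s \<and> G (Suc e) s < G (Suc e) r"
        using atom[OF assms(1), of e] pos row[of e r] by fastforce
    qed
  qed
  show ?thesis
  proof (cases "c \<le> ?e \<and> ?e \<noteq> 0")
    case True
    then have "0 < G ?e r" using le_sh_iff[of ?e r] by simp
    then have "0 < G ?e s" using * True by blast
    then show ?thesis using True le_sh_iff[of ?e s] by simp
  next
    case False
    moreover have "c \<le> ?e" using assms(2) le_sh_iff[of c r] by (cases "c = 0") auto
    ultimately show ?thesis by simp
  qed
qed

text \<open>In weakly increasing rows an inversion triple must satisfy \<open>k < j < i\<close>.
  Compared with key fillings the two types change roles: the one with two cells in column
  \<open>Suc c\<close> is refuted by \<open>atom\<close> alone, the other one by the
  lengths.\<close>

theorem rSSAF: "filling_of G \<in> rSSAF n"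
proof -
  have "non_attacking (augment n (filling_of G))"
  proof (rule non_attackingI)
    fix c r s x
    assume "augment n (filling_of G) (c, r) = Some x" "augment n (filling_of G) (c, s) = Some x"
    then show "r = s" using col_inj[of c r s] by (auto simp: augment_filling_of)
  next
    fix c r s x
    assume rs: "r < s" and "augment n (filling_of G) (c, s) = Some x"
      "augment n (filling_of G) (Suc c, r) = Some x"
    then have "0 < G c s" "G (Suc c) r = G c s" by (auto simp: augment_filling_of)
    then show False using atom[OF rs, of c] row[of c s] by fastforce
  qed
  moreover have "rows_weakly_increasing (augment n (filling_of G))"
    unfolding rows_weakly_increasing_def using row_mono by (auto simp: augment_filling_of)
  moreover have "\<not> inversion_triple t" if "t \<in> triples n (filling_of G)" for t
  proof
    obtain k i j where t: "t = (k, i, j)" by (cases t)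
    assume "inversion_triple t"
    then have inv: "(i > j \<and> j > k) \<or> (j > k \<and> k > i) \<or> (k > i \<and> i > j)"
      by (simp add: t inversion_triple_def)
    from that t obtain c r s where rs: "r < s" and
      "(sh (filling_of G) r > sh (filling_of G) s \<and> G c r = k \<and> G (Suc c) r = i \<and> G c s = j \<and> 0 < i \<and> 0 < j) \<or>
       (G c s = k \<and> G (Suc c) s = i \<and> 0 < k \<and> 0 < i \<and> 0 < j \<and> G (Suc c) r = j)"
      by (auto simp: triples_def augment_filling_of)
    then show False
    proof (elim disjE conjE)
      assume *: "sh (filling_of G) r > sh (filling_of G) s" "G c r = k" "G (Suc c) r = i" "G c s = j" "0 < i" "0 < j"
      then show False using inv row[of c r] atom[OF rs, of c] overtaken[OF rs, of "Suc c"] by auto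
    next
      assume "G c s = k" "G (Suc c) s = i" "0 < k" "0 < i" "0 < j" "G (Suc c) r = j"
      then show False using inv row[of c s] atom[OF rs, of c] by auto
    qed
  qed
  ultimately show ?thesis
    using ran_filling_of by (auto simp: rSSAF_def sh_compositions simp flip: dom_filling_of)
qed

end

section \<open>Adding or replacing a single entry\<close>

lemma (in skyline) bounded_ge: "\<exists>M\<ge>k. \<forall>r. G M r = 0"
proof -
  obtain M where "\<forall>r. G M r = 0" using bounded by blast
  then have "G (max k M) r = 0" for r
    using pos_mono[of "max k M" r M] by fastforce
  then show ?thesis by (meson max.cobounded1)
qed

lemma skyline_upd:
  assumes "skyline n G" and e: "1 \<le> e" and j: "0 < j" "j \<le> n" "\<And>q. G e q \<noteq> j" and left: "0 < G (e - 1) r"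
  shows "skyline n (G(e := (G e)(r := j)))"
proof -
  interpret skyline n G by fact
  obtain M where M: "M \<ge> Suc e" "\<forall>r. G M r = 0" using bounded_ge by blast
  show ?thesis
  proof
    show "(G(e := (G e)(r := j))) 0 = basement n" using base e by auto
    show "0 < (G(e := (G e)(r := j))) c q" if "0 < (G(e := (G e)(r := j))) (Suc c) q" for c q
      using that left_pos[of c q] j left by (auto split: if_splits)
    show "\<exists>M. \<forall>q. (G(e := (G e)(r := j))) M q = 0"
      using M by (intro exI[of _ M]) auto
    show "q = s" if "(G(e := (G e)(r := j))) c q = (G(e := (G e)(r := j))) c s"
      "0 < (G(e := (G e)(r := j))) c q" for c q s
      using that col_inj[of c q s] j(3) by (auto split: if_splits)
    show "(G(e := (G e)(r := j))) c q \<le> n" for c q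
      using le j by auto
  qed
qed

text \<open>The entry \<open>i\<close> is maximal and occurs only to the left of column
  \<open>d\<close>, so every entry from column \<open>d\<close> on is smaller. As the upper cell of
  \<open>atom\<close>, the new cell wins by its size. As the lower cell, it needs each higher row
  that reaches column \<open>d - 1\<close> to have a smaller entry in column \<open>d\<close> or a
  larger one in column \<open>d - 1\<close>; for rows up to \<open>i\<close> the former is
  \<open>top\<close>.\<close>

lemma atom_skyline_add:
  assumes "atom_skyline n H" and d: "1 \<le> d" "H d p = 0" "0 < H (d - 1) p"
    and i: "p \<le> i" "i \<le> n"
    and max: "\<And>c r. 1 \<le> c \<Longrightarrow> H c r \<le> i"
    and left: "\<And>c r. 1 \<le> c \<Longrightarrow> H c r = i \<Longrightarrow> c < d"
    and top: "\<And>q. p < q \<Longrightarrow> q \<le> i \<Longrightarrow> 0 < H (d - 1) q \<Longrightarrow> 0 < H d q"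
  shows "atom_skyline n (H(d := (H d)(p := i)))"
proof -
  interpret atom_skyline n H by fact
  have p: "1 \<le> p" "p \<le> n" using row_range d(3) by auto
  have base': "H 0 q = q" if "0 < H 0 q" for q
    using that by (auto simp: base basement_def)
  have nosuc: "H (Suc d) p = 0" using left_pos[of d p] d by auto
  interpret H': skyline n "H(d := (H d)(p := i))"
  proof (rule skyline_upd)
    show "H d q \<noteq> i" for q using left[of d q] d by blast
  qed (use d i p in \<open>auto intro: skyline_axioms\<close>)
  have less: "H c r < i" if "d \<le> c" for c r
    using max[of c r] left[of c r] that d by fastforce
  show ?thesis
  proof
    fix c r
    assume *: "0 < (H(d := (H d)(p := i))) (Suc c) r"
    have "H c p \<le> i" if "Suc c = d"
      using max[of c p] base'[of p] d i that by (cases c) auto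
    then show "(H(d := (H d)(p := i))) c r \<le> (H(d := (H d)(p := i))) (Suc c) r"
      using * row[of c r] nosuc by (auto split: if_splits)
  next
    fix c r s :: nat
    assume rs: "r < s" and s: "0 < (H(d := (H d)(p := i))) c s"
      and r: "0 < (H(d := (H d)(p := i))) (Suc c) r"
    consider (a) "Suc c = d" "r = p" | (b) "Suc c = d" "s = p" | (c) "c = d" "s = p"
      | (e) "c = d" "r = p" | (f) "c \<noteq> d \<or> s \<noteq> p" "c \<noteq> d \<or> r \<noteq> p" "Suc c \<noteq> d \<or> r \<noteq> p" "Suc c \<noteq> d \<or> s \<noteq> p"
      by blast
    then show "(H(d := (H d)(p := i))) (Suc c) r < (H(d := (H d)(p := i))) c s \<or>
        0 < (H(d := (H d)(p := i))) (Suc c) s \<and>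
        (H(d := (H d)(p := i))) (Suc c) s < (H(d := (H d)(p := i))) (Suc c) r"
    proof cases
      case a
      then have cs: "0 < H c s" using s by auto
      show ?thesis
      proof (cases "s \<le> i")
        case True
        then show ?thesis using a rs cs top[of s] less[of d s] by auto
      next
        case False
        \<comment> \<open>Here \<open>top\<close> is silent, but a row \<open>s > i\<close> starts
          with \<open>s\<close> in the basement and only increases.\<close>
        have "H 0 s = s" using base' pos_mono[OF cs, of 0] by simp
        then have "i < H c s" using row_mono[of 0 c s] cs False by simp
        then show ?thesis using a by simp
      qed
    next
      case b
      then show ?thesis using rs r s atom[of r s c] d by auto
    next
      case c
      then show ?thesis using rs less[of "Suc d" r] by auto
    next
      case e
      then show ?thesis using r nosuc by auto
    next
      case f
      then show ?thesis using rs r s atom[of r s c] by (auto split: if_splits)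
    qed
  qed
qed

text \<open>The danger is that the larger entry \<open>j\<close> in row \<open>r\<close> beats a
  higher row \<open>s\<close> that the old entry did not beat. By \<open>top\<close> such a row has
  an entry below \<open>j\<close> in column \<open>e - 1\<close> already, so row \<open>r\<close>
  was ahead there, and two uses of \<open>key\<close> carry the lead to column \<open>Suc e\<close>.
  For lower rows compared with the new entry, \<open>key\<close> is exactly
  \<open>below\<close>.\<close>

lemma key_skyline_replace:
  assumes "key_skyline n G" and e: "1 \<le> e" and j: "0 < j" "j \<le> G (e - 1) r" "G e r < j"
    and notin: "\<And>q. G e q \<noteq> j"
    and top: "\<And>s. r < s \<Longrightarrow> j \<le> G (e - 1) s \<Longrightarrow> j \<le> G e s"
    and below: "\<And>q. q < r \<Longrightarrow> j < G e q \<Longrightarrow> j < G (Suc e) q"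
  shows "key_skyline n (G(e := (G e)(r := j)))"
proof -
  interpret key_skyline n G by fact
  have jn: "j \<le> n" using j(2) le[of "e - 1" r] by simp
  interpret G': skyline n "G(e := (G e)(r := j))"
    by (rule skyline_upd) (use e j jn notin skyline_axioms in auto)
  show ?thesis
  proof
    fix c q
    show "(G(e := (G e)(r := j))) (Suc c) q \<le> (G(e := (G e)(r := j))) c q"
      using row[of c q] j by (cases "c = e"; cases "Suc c = e"; cases "q = r") auto
  next
    fix c q s :: nat
    assume qs: "q < s" and lt: "(G(e := (G e)(r := j))) c s < (G(e := (G e)(r := j))) c q"
      and pos: "0 < (G(e := (G e)(r := j))) c s"
    consider (a) "Suc c = e" "q = r" | (b) "c = e" "q = r" | (c) "c = e" "s = r"
      | (d) "c \<noteq> e \<or> s \<noteq> r" "c \<noteq> e \<or> q \<noteq> r" "Suc c \<noteq> e \<or> q \<noteq> r"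
      by blast
    then show "(G(e := (G e)(r := j))) c s < (G(e := (G e)(r := j))) (Suc c) q"
    proof cases
      case a
      then show ?thesis using qs lt pos key[of q s c] j by auto
    next
      case b
      then have s: "0 < G e s" "G e s < j" using lt pos qs by auto
      have le': "G e s \<le> G (e - 1) s" using row[of "e - 1" s] e by simp
      have "G (e - 1) s < j" using top[of s] b qs s by fastforce
      then have "G (e - 1) s < G e r" using key[of r s "e - 1"] b qs s j le' e by auto
      then have "G e s < G (Suc e) r" using key[of r s e] b qs s le' by auto
      then show ?thesis using b qs by auto
    next
      case c
      then show ?thesis using lt qs below[of q] by auto
    next
      case d
      then show ?thesis using qs lt pos key[of q s c] by (auto split: if_splits)
    qed
  qed
qed

section \<open>Tableaux with given column sets\<close>

text \<open>For \<open>x\<close> in \<open>A\<close> this is the row of \<open>x\<close> in the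
  sorted column: \<open>R\<close> is \<open>(\<le>)\<close> when columns decrease upwards (reverse
  tableaux) and \<open>(\<ge>)\<close> when they increase. For other \<open>x\<close> it still
  counts the entries at or beyond the threshold \<open>x\<close>.\<close>

definition rank :: "(nat \<Rightarrow> nat \<Rightarrow> bool) \<Rightarrow> nat set \<Rightarrow> nat \<Rightarrow> nat" where
  "rank R A x = card {y \<in> A. R x y}"

definition column_tableau :: "(nat \<Rightarrow> nat \<Rightarrow> bool) \<Rightarrow> (nat \<Rightarrow> nat set) \<Rightarrow> filling" where
  "column_tableau R C = (\<lambda>(c, r). if 1 \<le> c \<and> (\<exists>x \<in> C c. rank R (C c) x = r)
     then Some (THE x. x \<in> C c \<and> rank R (C c) x = r) else None)"

locale column_order =
  fixes R :: "nat \<Rightarrow> nat \<Rightarrow> bool"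
  assumes refl: "R x x" and total: "R x y \<or> R y x" and antisym: "R x y \<Longrightarrow> R y x \<Longrightarrow> x = y"
    and trans: "R x y \<Longrightarrow> R y z \<Longrightarrow> R x z"
begin

lemma rank_mono: "finite A \<Longrightarrow> R x y \<Longrightarrow> rank R A y \<le> rank R A x"
  unfolding rank_def by (rule card_mono) (auto intro: trans[of x y])

lemma rank_less: "finite A \<Longrightarrow> x \<in> A \<Longrightarrow> R x y \<Longrightarrow> x \<noteq> y \<Longrightarrow> rank R A y < rank R A x"
  unfolding rank_def by (rule psubset_card_mono) (use antisym refl in \<open>auto intro: trans[of x y]\<close>)

lemma rank_inj: "finite A \<Longrightarrow> x \<in> A \<Longrightarrow> y \<in> A \<Longrightarrow> rank R A x = rank R A y \<Longrightarrow> x = y"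
  using rank_less[of A x y] rank_less[of A y x] total[of x y] by (cases "x = y") auto

lemma rank_image: "finite A \<Longrightarrow> rank R A ` A = {1..card A}"
proof -
  assume A: "finite A"
  have "rank R A ` A \<subseteq> {1..card A}"
  proof (clarify)
    fix x assume "x \<in> A"
    then have "{y \<in> A. R x y} \<noteq> {}" using refl by blast
    then have "1 \<le> rank R A x" unfolding rank_def using A by (simp add: Suc_le_eq card_gt_0_iff)
    moreover have "rank R A x \<le> card A" unfolding rank_def using A by (intro card_mono) auto
    ultimately show "rank R A x \<in> {1..card A}" by simp
  qed
  moreover have "card (rank R A ` A) = card A"
    by (rule card_image, rule inj_onI, rule rank_inj[OF A])
  ultimately show ?thesis by (intro card_subset_eq) auto
qed

lemma column_tableau_eq_Some:
  assumes "finite (C c)"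
  shows "column_tableau R C (c, r) = Some x \<longleftrightarrow> 1 \<le> c \<and> x \<in> C c \<and> rank R (C c) x = r"
proof -
  have "(THE y. y \<in> C c \<and> rank R (C c) y = r) = x" if "x \<in> C c" "rank R (C c) x = r" for x
  proof (rule the_equality)
    show "y = x" if "y \<in> C c \<and> rank R (C c) y = r" for y
      using rank_inj[OF assms, of y x] that \<open>x \<in> C c\<close> \<open>rank R (C c) x = r\<close> by simp
  qed (use that in simp)
  then show ?thesis by (auto simp: column_tableau_def)
qed

lemma mem_dom_column_tableau:
  assumes "finite (C c)"
  shows "(c, r) \<in> dom (column_tableau R C) \<longleftrightarrow> 1 \<le> c \<and> 1 \<le> r \<and> r \<le> card (C c)"
proof -
  have "(c, r) \<in> dom (column_tableau R C) \<longleftrightarrow> 1 \<le> c \<and> r \<in> rank R (C c) ` C c"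
    by (auto simp: column_tableau_def dom_def)
  then show ?thesis using rank_image[OF assms] by simp
qed

lemma column_set_column_tableau:
  "finite (C c) \<Longrightarrow> 1 \<le> c \<Longrightarrow> column_set (column_tableau R C) c = C c"
  by (auto simp: column_set_def column_tableau_eq_Some)

lemma column_tableau_cong: "(\<And>c. 1 \<le> c \<Longrightarrow> C c = D c) \<Longrightarrow> column_tableau R C = column_tableau R D"
  by (auto simp: column_tableau_def fun_eq_iff)

text \<open>Every old entry precedes \<open>j\<close> in the column, so \<open>j\<close> goes on top
  and no other rank changes.\<close>

lemma column_tableau_insert:
  assumes fin: "\<And>c. finite (C c)" and c: "1 \<le> c" and j: "\<And>x. x \<in> C c \<Longrightarrow> \<not> R x j"
  shows "column_tableau R (C(c := insert j (C c))) = (column_tableau R C)((c, Suc (card (C c))) \<mapsto> j)"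
proof (rule ext, rule option.expand)
  let ?D = "C(c := insert j (C c))"
  have fin': "finite (?D d)" for d using fin by simp
  have jn: "j \<notin> C c" using j refl by blast
  have rank_j: "rank R (insert j (C c)) j = Suc (card (C c))"
  proof -
    have "{y \<in> insert j (C c). R j y} = insert j (C c)" using j total refl by blast
    then show ?thesis using jn fin by (simp add: rank_def)
  qed
  have rank_x: "rank R (insert j (C c)) x = rank R (C c) x" if "x \<in> C c" for x
    unfolding rank_def by (rule arg_cong[of _ _ card]) (use j that in auto)
  have le: "rank R (C c) x \<le> card (C c)" for x
    unfolding rank_def using fin by (intro card_mono) auto
  have *: "column_tableau R ?D u = Some x \<longleftrightarrow>
    ((column_tableau R C)((c, Suc (card (C c))) \<mapsto> j)) u = Some x" for u x
  proof -
    obtain d r where u: "u = (d, r)" by (cases u)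
    show ?thesis unfolding u column_tableau_eq_Some[where C="?D", OF fin']
      using column_tableau_eq_Some[OF fin] rank_j rank_x le[of x] c jn by auto
  qed
  fix u
  show "(column_tableau R ?D u = None) = (((column_tableau R C)((c, Suc (card (C c))) \<mapsto> j)) u = None)"
    using *[of u] by (metis not_None_eq)
  show "the (column_tableau R ?D u) = the (((column_tableau R C)((c, Suc (card (C c))) \<mapsto> j)) u)"
    if "column_tableau R ?D u \<noteq> None" "((column_tableau R C)((c, Suc (card (C c))) \<mapsto> j)) u \<noteq> None"
    using *[of u] that by (metis option.exhaust_sel)
qed

text \<open>A partition shape leaves no gaps in a column, so the entries counted by the rank of
  \<open>x\<close> are those in rows 1 to \<open>r\<close>, and the rank recovers the row.\<close>

lemma eq_column_tableau:
  assumes fin: "\<And>c. finite (column_set P c)" and sh: "sh P \<in> partitions" and dom: "dom P = diagram (sh P)"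
    and strict: "\<And>c r s x y. r < s \<Longrightarrow> P (c, r) = Some x \<Longrightarrow> P (c, s) = Some y \<Longrightarrow> R y x \<and> x \<noteq> y"
  shows "P = column_tableau R (column_set P)"
proof -
  have rank: "rank R (column_set P c) x = r" and c: "1 \<le> c" if P: "P (c, r) = Some x" for c r x
  proof -
    have cr: "(c, r) \<in> diagram (sh P)" using P dom by blast
    then show "1 \<le> c" by (simp add: diagram_def)
    have "sh P r \<noteq> 0" using cr by (auto simp: diagram_def)
    then have r: "1 \<le> r" using sh by (force simp: partitions_def compositions_def)
    have pos: "(c, s) \<in> dom P" if "1 \<le> s" "s \<le> r" for s
    proof -
      have "sh P r \<le> sh P s" using sh that by (simp add: partitions_def)
      then show ?thesis using cr dom by (auto simp: diagram_def)
    qed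
    have pos': "1 \<le> s" if "(c, s) \<in> dom P" for s
    proof -
      have "sh P s \<noteq> 0" using that dom by (auto simp: diagram_def)
      then show "1 \<le> s" using sh by (force simp: partitions_def compositions_def)
    qed
    have less: "x' = x \<and> s = r \<or> R x x' \<and> x \<noteq> x' \<and> s < r \<or> R x' x \<and> x \<noteq> x' \<and> r < s"
      if "P (c, s) = Some x'" for s x'
    proof (cases s r rule: linorder_cases)
      case less
      then show ?thesis using strict[OF less that P] by blast
    next
      case equal
      then show ?thesis using that P by simp
    next
      case greater
      then show ?thesis using strict[OF greater P that] by blast
    qed
    have "{y \<in> column_set P c. R x y} = (\<lambda>s. the (P (c, s))) ` {1..r}"
    proof (intro set_eqI iffI)
      fix y assume y: "y \<in> {y \<in> column_set P c. R x y}"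
      then obtain s where s: "P (c, s) = Some y" by (auto simp: column_set_def)
      then have "s \<le> r" using less[OF s] y antisym[of x y] by auto
      then show "y \<in> (\<lambda>s. the (P (c, s))) ` {1..r}" using s pos'[of s] by force
    next
      fix y assume "y \<in> (\<lambda>s. the (P (c, s))) ` {1..r}"
      then obtain s where s: "1 \<le> s" "s \<le> r" "P (c, s) = Some y" using pos by fastforce
      then have "R x y" using less[OF s(3)] refl by auto
      then show "y \<in> {y \<in> column_set P c. R x y}" using s by (auto simp: column_set_def)
    qed
    moreover have "inj_on (\<lambda>s. the (P (c, s))) {1..r}"
    proof (rule inj_onI)
      fix s t assume st: "s \<in> {1..r}" "t \<in> {1..r}" "the (P (c, s)) = the (P (c, t))"
      then obtain y where "P (c, s) = Some y" "P (c, t) = Some y"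
        using pos[of s] pos[of t] by fastforce
      then show "s = t" using strict[of s t c y y] strict[of t s c y y] by (cases s t rule: linorder_cases) auto
    qed
    ultimately show "rank R (column_set P c) x = r" by (simp add: rank_def card_image)
  qed
  have *: "P u = Some x \<longleftrightarrow> column_tableau R (column_set P) u = Some x" for u x
  proof -
    obtain c r where u: "u = (c, r)" by (cases u)
    show ?thesis unfolding u column_tableau_eq_Some[where C="column_set P", OF fin]
    proof
      assume "P (c, r) = Some x"
      then show "1 \<le> c \<and> x \<in> column_set P c \<and> rank R (column_set P c) x = r"
        using rank c by (auto simp: column_set_def)
    next
      assume a: "1 \<le> c \<and> x \<in> column_set P c \<and> rank R (column_set P c) x = r"
      then obtain s where "P (c, s) = Some x" by (auto simp: column_set_def)
      with a rank show "P (c, r) = Some x" by blast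
    qed
  qed
  show ?thesis
  proof
    fix u show "P u = column_tableau R (column_set P) u"
      using *[of u] by (metis not_None_eq)
  qed
qed

end

interpretation decreasing: column_order "(\<le>)" by unfold_locales auto

interpretation increasing: column_order "(\<ge>)" by unfold_locales auto

text \<open>Weak monotonicity of rows, expressed by column sets: at every threshold the left column
  has at least as many entries beyond it (\<open>ranks\<close>). The condition \<open>card\<close>
  makes the shape a partition.\<close>

locale interlaced = column_order +
  fixes C :: "nat \<Rightarrow> nat set"
  assumes fin: "\<And>c. finite (C c)"
    and card: "\<And>c. 1 \<le> c \<Longrightarrow> card (C (Suc c)) \<le> card (C c)"
    and empty: "\<exists>M\<ge>1. C M = {}"
    and ranks: "\<And>c x. 1 \<le> c \<Longrightarrow> rank R (C (Suc c)) x \<le> rank R (C c) x"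
begin

lemma card_antimono: "1 \<le> c \<Longrightarrow> c \<le> d \<Longrightarrow> card (C d) \<le> card (C c)"
proof (rotate_tac, induction d rule: dec_induct)
  case (step d)
  then show ?case using card[of d] by linarith
qed simp

lemma rank_antimono: "1 \<le> c \<Longrightarrow> c \<le> d \<Longrightarrow> rank R (C d) x \<le> rank R (C c) x"
proof (rotate_tac, induction d rule: dec_induct)
  case (step d)
  then show ?case using ranks[of d x] by linarith
qed simp

lemma le_sh_column_tableau:
  assumes "1 \<le> c" "1 \<le> r"
  shows "c \<le> sh (column_tableau R C) r \<longleftrightarrow> r \<le> card (C c)"
proof -
  obtain M where M: "1 \<le> M" "C M = {}" using empty by blast
  let ?A = "{c. 1 \<le> c \<and> r \<le> card (C c)}"
  have sub: "?A \<subseteq> {..M}"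
  proof
    fix d assume d: "d \<in> ?A"
    show "d \<in> {..M}" using d assms(2) card_antimono[of M d] M by (cases "d \<le> M") auto
  qed
  then have finA: "finite ?A" by (rule finite_subset) simp
  have sh: "sh (column_tableau R C) r = card ?A"
    using assms(2) by (simp add: sh_def mem_dom_column_tableau fin)
  show ?thesis
  proof
    assume "r \<le> card (C c)"
    then have "{1..c} \<subseteq> ?A" using card_antimono[of _ c] by fastforce
    then show "c \<le> sh (column_tableau R C) r"
      using card_mono[OF finA] sh by (metis card_atLeastAtMost diff_Suc_1)
  next
    assume le: "c \<le> sh (column_tableau R C) r"
    show "r \<le> card (C c)"
    proof (rule ccontr)
      assume "\<not> r \<le> card (C c)"
      then have "d < c" if "r \<le> card (C d)" for d
        using card_antimono[of c d] that assms by (cases "c \<le> d") auto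
      then have "?A \<subseteq> {1..<c}" by auto
      then have "card ?A \<le> c - 1" using card_mono[of "{1..<c}" ?A] by simp
      then show False using le sh assms by simp
    qed
  qed
qed

lemma sh_column_tableau_0: "sh (column_tableau R C) 0 = 0"
  by (simp add: sh_def mem_dom_column_tableau fin)

lemma dom_column_tableau: "dom (column_tableau R C) = diagram (sh (column_tableau R C))"
proof (rule set_eqI)
  fix u :: cell
  obtain c r where u: "u = (c, r)" by (cases u)
  show "u \<in> dom (column_tableau R C) \<longleftrightarrow> u \<in> diagram (sh (column_tableau R C))"
    unfolding u mem_dom_column_tableau[OF fin]
    using le_sh_column_tableau[of c r] sh_column_tableau_0 by (cases "r = 0") (auto simp: diagram_def)
qed

lemma sh_partitions: "sh (column_tableau R C) \<in> partitions"
proof -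
  have "sh (column_tableau R C) \<in> compositions (card (C 1))"
    unfolding compositions_def
  proof (rule CollectI, intro allI impI)
    fix r assume r: "sh (column_tableau R C) r \<noteq> 0"
    then have "r \<noteq> 0" using sh_column_tableau_0 by metis
    then show "r \<in> {1..card (C 1)}" using le_sh_column_tableau[of 1 r] r by simp
  qed
  moreover have "sh (column_tableau R C) s \<le> sh (column_tableau R C) r" if "1 \<le> r" "r \<le> s" for r s
    using le_sh_column_tableau[of "sh (column_tableau R C) s" s] that
      le_sh_column_tableau[of "sh (column_tableau R C) s" r]
    by (cases "sh (column_tableau R C) s = 0") auto
  ultimately show ?thesis unfolding partitions_def by blast
qed

lemma column_strict:
  assumes "r < s" "column_tableau R C (c, r) = Some x" "column_tableau R C (c, s) = Some y"
  shows "R y x \<and> x \<noteq> y"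
proof -
  have "x \<in> C c" "rank R (C c) x = r" "y \<in> C c" "rank R (C c) y = s"
    using assms column_tableau_eq_Some[OF fin] by auto
  then show ?thesis using assms(1) rank_mono[of "C c" x y] total[of x y] fin by fastforce
qed

text \<open>Otherwise \<open>x\<close>, in row \<open>r\<close> of column \<open>c\<close>, would
  strictly precede \<open>y\<close>, so column \<open>c\<close> would have fewer than
  \<open>r\<close> entries counted by the rank of \<open>y\<close>, although column \<open>d\<close>
  has \<open>r\<close> of them.\<close>

lemma row_weak:
  assumes "c < d" "column_tableau R C (c, r) = Some x" "column_tableau R C (d, r) = Some y"
  shows "R y x"
proof (rule ccontr)
  have *: "1 \<le> c" "x \<in> C c" "rank R (C c) x = r" "y \<in> C d" "rank R (C d) y = r"
    using assms column_tableau_eq_Some[OF fin] by auto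
  assume "\<not> R y x"
  then have "R x y" "x \<noteq> y" using total refl by blast+
  then have "rank R (C c) y < r" using rank_less[of "C c" x y] * fin by simp
  then show False using rank_antimono[of c d y] * assms(1) by simp
qed

lemma ran_column_tableau: "x \<in> ran (column_tableau R C) \<Longrightarrow> \<exists>c\<ge>1. x \<in> C c"
  using column_tableau_eq_Some[OF fin] by (auto simp: ran_def)

end

lemma interlaced_rSSYT:
  assumes "interlaced (\<le>) C" and "\<And>c. 1 \<le> c \<Longrightarrow> C c \<subseteq> {1..n}"
  shows "column_tableau (\<le>) C \<in> rSSYT n"
proof -
  interpret interlaced "(\<le>)" C by fact
  have "columns_strictly_decreasing (column_tableau (\<le>) C)"
    unfolding columns_strictly_decreasing_def using column_strict by (metis order_le_less)
  moreover have "rows_weakly_decreasing (column_tableau (\<le>) C)"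
    unfolding rows_weakly_decreasing_def using row_weak by metis
  moreover have "ran (column_tableau (\<le>) C) \<subseteq> {1..n}"
    using ran_column_tableau assms(2) by blast
  ultimately show ?thesis
    using sh_partitions dom_column_tableau by (simp add: rSSYT_def)
qed

lemma interlaced_SSYT:
  assumes "interlaced (\<ge>) C" and "\<And>c. 1 \<le> c \<Longrightarrow> C c \<subseteq> {1..n}"
  shows "column_tableau (\<ge>) C \<in> SSYT n"
proof -
  interpret interlaced "(\<ge>)" C by fact
  have "columns_strictly_increasing (column_tableau (\<ge>) C)"
    unfolding columns_strictly_increasing_def using column_strict by (metis order_le_less)
  moreover have "rows_weakly_increasing (column_tableau (\<ge>) C)"
    unfolding rows_weakly_increasing_def using row_weak by metis
  moreover have "ran (column_tableau (\<ge>) C) \<subseteq> {1..n}"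
    using ran_column_tableau assms(2) by blast
  ultimately show ?thesis
    using sh_partitions dom_column_tableau by (simp add: SSYT_def)
qed

lemma finite_column_set: "ran P \<subseteq> {1..n} \<Longrightarrow> finite (column_set P c)"
  by (rule finite_subset[of _ "{1..n::nat}"]) (auto simp: column_set_def ran_def)

text \<open>Columns are compared from 1 on, since \<open>C 0\<close> may be the basement, which the
  filling does not contain. Uniqueness is \<open>eq_column_tableau\<close>.\<close>

lemma \<tau>_eq:
  assumes "interlaced (\<le>) C" "\<And>c. 1 \<le> c \<Longrightarrow> C c \<subseteq> {1..n}" "\<And>c. 1 \<le> c \<Longrightarrow> column_set S c = C c"
  shows "\<tau> n S = column_tableau (\<le>) C"
  unfolding \<tau>_def
proof (rule the_equality)
  interpret interlaced "(\<le>)" C by fact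
  show "column_tableau (\<le>) C \<in> rSSYT n \<and> (\<forall>c\<ge>1. column_set (column_tableau (\<le>) C) c = column_set S c)"
    using interlaced_rSSYT[OF assms(1,2)] assms(3) decreasing.column_set_column_tableau fin by simp
  fix P assume P: "P \<in> rSSYT n \<and> (\<forall>c\<ge>1. column_set P c = column_set S c)"
  have "P = column_tableau (\<le>) (column_set P)"
  proof (rule decreasing.eq_column_tableau)
    show "finite (column_set P c)" for c
      using P finite_column_set[of P n] by (simp add: rSSYT_def)
    show "sh P \<in> partitions" "dom P = diagram (sh P)" using P by (simp_all add: rSSYT_def)
    have "columns_strictly_decreasing P" using P by (simp add: rSSYT_def)
    then have "y < x" if "r < s" "P (c, r) = Some x" "P (c, s) = Some y" for c r s x y
      using that unfolding columns_strictly_decreasing_def by blast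
    then show "y \<le> x \<and> x \<noteq> y" if "r < s" "P (c, r) = Some x" "P (c, s) = Some y" for c r s x y
      using that by fastforce
  qed
  also have "\<dots> = column_tableau (\<le>) C"
    by (rule decreasing.column_tableau_cong) (use P assms(3) in auto)
  finally show "P = column_tableau (\<le>) C" .
qed

lemma \<rho>_eq:
  assumes "interlaced (\<ge>) C" "\<And>c. 1 \<le> c \<Longrightarrow> C c \<subseteq> {1..n}" "\<And>c. 1 \<le> c \<Longrightarrow> column_set T c = C c"
  shows "\<rho> n T = column_tableau (\<ge>) C"
  unfolding \<rho>_def
proof (rule the_equality)
  interpret interlaced "(\<ge>)" C by fact
  show "column_tableau (\<ge>) C \<in> SSYT n \<and> (\<forall>c\<ge>1. column_set (column_tableau (\<ge>) C) c = column_set T c)"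
    using interlaced_SSYT[OF assms(1,2)] assms(3) increasing.column_set_column_tableau fin by simp
  fix P assume P: "P \<in> SSYT n \<and> (\<forall>c\<ge>1. column_set P c = column_set T c)"
  have "P = column_tableau (\<ge>) (column_set P)"
  proof (rule increasing.eq_column_tableau)
    show "finite (column_set P c)" for c
      using P finite_column_set[of P n] by (simp add: SSYT_def)
    show "sh P \<in> partitions" "dom P = diagram (sh P)" using P by (simp_all add: SSYT_def)
    have "columns_strictly_increasing P" using P by (simp add: SSYT_def)
    then have "x < y" if "r < s" "P (c, r) = Some x" "P (c, s) = Some y" for c r s x y
      using that unfolding columns_strictly_increasing_def by blast
    then show "y \<ge> x \<and> x \<noteq> y" if "r < s" "P (c, r) = Some x" "P (c, s) = Some y" for c r s x y
      using that by fastforce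
  qed
  also have "\<dots> = column_tableau (\<ge>) C"
    by (rule increasing.column_tableau_cong) (use P assms(3) in auto)
  finally show "P = column_tableau (\<ge>) C" .
qed

section \<open>Row insertion\<close>

text \<open>\<open>inserts r P j P' e\<close> also records the column \<open>e\<close> of the new cell.\<close>

inductive inserts :: "nat \<Rightarrow> filling \<Rightarrow> nat \<Rightarrow> filling \<Rightarrow> nat \<Rightarrow> bool" where
  stop: "1 \<le> c \<Longrightarrow> (\<And>d. 1 \<le> d \<Longrightarrow> d < c \<Longrightarrow> \<not> accepts j (P (d, r))) \<Longrightarrow> P (c, r) = None \<Longrightarrow>
    inserts r P j (P((c, r) \<mapsto> j)) c"
| bump: "1 \<le> c \<Longrightarrow> (\<And>d. 1 \<le> d \<Longrightarrow> d < c \<Longrightarrow> \<not> accepts j (P (d, r))) \<Longrightarrow> P (c, r) = Some k \<Longrightarrow> k < j \<Longrightarrow>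
    inserts (Suc r) (P((c, r) \<mapsto> j)) k P' e \<Longrightarrow> inserts r P j P' e"

lemma row_insert_from_inserts: "inserts r P j P' e \<Longrightarrow> row_insert_from r P j = P'"
proof (induction rule: inserts.induct)
  case (stop c j P r)
  have "(LEAST c. 1 \<le> c \<and> accepts j (P (c, r))) = c"
    by (rule Least_equality) (use stop in \<open>auto simp: accepts_def not_less[symmetric]\<close>)
  then show ?case using stop by (subst row_insert_from.simps) (simp add: Let_def)
next
  case (bump c j P r k P' e)
  have "(LEAST c. 1 \<le> c \<and> accepts j (P (c, r))) = c"
    by (rule Least_equality) (use bump in \<open>auto simp: accepts_def not_less[symmetric]\<close>)
  then show ?case using bump.hyps bump.IH by (subst row_insert_from.simps) (simp add: Let_def del: fun_upd_apply)
qed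

lemma inserts_below: "inserts r P j P' e \<Longrightarrow> s < r \<Longrightarrow> P' (c, s) = P (c, s)"
  by (induction rule: inserts.induct) auto

text \<open>Insertion from row \<open>r\<close> upwards never looks below row \<open>r\<close>. This
  lets the row bumping argument undo a change made in a row already passed.\<close>

lemma inserts_upd_below: "inserts r P j P' e \<Longrightarrow> s < r \<Longrightarrow> inserts r (P((c, s) := v)) j (P'((c, s) := v)) e"
proof (induction rule: inserts.induct)
  case (stop d j P r)
  then have "inserts r (P((c, s) := v)) j (P((c, s) := v, (d, r) \<mapsto> j)) d"
    by (intro inserts.stop) auto
  moreover have "P((c, s) := v, (d, r) \<mapsto> j) = P((d, r) \<mapsto> j, (c, s) := v)"
    using stop.prems by (intro fun_upd_twist) auto
  ultimately show ?case by (simp only:)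
next
  case (bump d j P r k P' e)
  have "P((d, r) \<mapsto> j, (c, s) := v) = P((c, s) := v, (d, r) \<mapsto> j)"
    using bump.prems by (intro fun_upd_twist) auto
  moreover have "inserts (Suc r) (P((d, r) \<mapsto> j, (c, s) := v)) k (P'((c, s) := v)) e"
    by (rule bump.IH) (use bump.prems in simp)
  ultimately have rest: "inserts (Suc r) (P((c, s) := v, (d, r) \<mapsto> j)) k (P'((c, s) := v)) e"
    by (simp only:)
  show ?case
    by (rule inserts.bump[OF bump.hyps(1) _ _ bump.hyps(4) rest]) (use bump.hyps bump.prems in auto)
qed

text \<open>Bumping paths move weakly to the left: the entry above a bumped one is smaller, so its
  cell accepts the bumped entry, and the leftmost accepting cell is no further right.\<close>

lemma inserts_weakly_left:
  assumes "inserts r P j P' e" "1 \<le> c" "accepts j (P (c, r))"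
    and "\<And>c s x y. r \<le> s \<Longrightarrow> P (c, s) = Some x \<Longrightarrow> P (c, Suc s) = Some y \<Longrightarrow> y < x"
  shows "e \<le> c"
  using assms
proof (induction arbitrary: c rule: inserts.induct)
  case (stop d j P r)
  then show ?case by (metis not_le)
next
  case (bump d j P r k P' e)
  have d: "d \<le> c" using bump by (metis not_le)
  have "e \<le> d"
  proof (rule bump.IH)
    show "accepts k ((P((d, r) \<mapsto> j)) (d, Suc r))"
      using bump.prems(3)[of r d k] bump.hyps(3) by (auto simp: accepts_def split: option.split)
    show "y < x" if "Suc r \<le> s" "(P((d, r) \<mapsto> j)) (c, s) = Some x" "(P((d, r) \<mapsto> j)) (c, Suc s) = Some y"
      for c s x y
      using bump.prems(3)[of s c x y] that by auto
  qed (use bump in auto)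
  then show ?case using d by simp
qed

text \<open>In each row the second path runs strictly to the right of the first: after the first
  insertion all entries up to its column are at least \<open>j\<close>, hence at least
  \<open>k\<close>. The two bumped entries are then again in weakly decreasing order. If the first
  path stops, nothing lies further right in that row; if the second one stops, the first can only
  continue weakly to the left.\<close>

lemma row_bumping:
  assumes "inserts r P j P1 c1" "inserts r P1 k P2 c2" "k \<le> j"
    and "\<And>c s x y. r \<le> s \<Longrightarrow> P (c, s) = Some x \<Longrightarrow> P (c, Suc s) = Some y \<Longrightarrow> y < x"
    and "\<And>c d s y. r \<le> s \<Longrightarrow> 1 \<le> c \<Longrightarrow> c < d \<Longrightarrow> P (d, s) = Some y \<Longrightarrow> \<exists>x\<ge>y. P (c, s) = Some x"
  shows "c1 < c2"
  using assms
proof (induction arbitrary: k P2 rule: inserts.induct)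
  case (stop c j P r)
  have right: "c < e" if "1 \<le> e" "accepts k ((P((c, r) \<mapsto> j)) (e, r))" for e
  proof (rule ccontr)
    assume "\<not> c < e"
    then show False using that stop.hyps(2)[of e] stop.prems(2)
      by (cases "e = c") (auto simp: accepts_def split: option.splits)
  qed
  from stop.prems(1) show ?case
  proof (cases rule: inserts.cases)
    case (stop)
    then show ?thesis using right[of c2] by (auto simp: accepts_def)
  next
    case (bump e y)
    have "c < e" using right[of e] bump by (auto simp: accepts_def)
    then have "P (e, r) = Some y" using bump by simp
    then show ?thesis using stop.prems(4)[of r c e y] stop.hyps(1,3) \<open>c < e\<close> by auto
  qed
next
  case (bump c j P r y P1 c1)
  have P1: "P1 (d, r) = (P((c, r) \<mapsto> j)) (d, r)" for d
    using inserts_below[OF bump.hyps(5), of r d] by simp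
  have right: "c < e" if "1 \<le> e" "accepts k (P1 (e, r))" for e
  proof (rule ccontr)
    assume "\<not> c < e"
    then show False using that bump.hyps(2)[of e] bump.prems(2) P1[of e]
      by (cases "e = c") (auto simp: accepts_def split: option.splits)
  qed
  have c1: "c1 \<le> c"
  proof (rule inserts_weakly_left[OF bump.hyps(5,1)])
    show "accepts y ((P((c, r) \<mapsto> j)) (c, Suc r))"
      using bump.prems(3)[of r c y] bump.hyps(3) by (auto simp: accepts_def split: option.split)
    show "z < x" if "Suc r \<le> s" "(P((c, r) \<mapsto> j)) (d, s) = Some x" "(P((c, r) \<mapsto> j)) (d, Suc s) = Some z"
      for d s x z
      using bump.prems(3)[of s d x z] that by auto
  qed
  from bump.prems(1) show ?case
  proof (cases rule: inserts.cases)
    case stop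
    then show ?thesis using right[of c2] c1 by (auto simp: accepts_def)
  next
    case (bump e z)
    have ce: "c < e" using right[of e] bump by (auto simp: accepts_def)
    then have "P (e, r) = Some z" using bump P1[of e] by simp
    then have zy: "z \<le> y" using bump.prems(4)[of r c e z] bump.hyps(1,3) ce by auto
    \<comment> \<open>The second insertion has changed cell \<open>(e, r)\<close>; restoring it
      gives an insertion into \<open>P1\<close> itself, as the induction hypothesis
      requires.\<close>
    have "inserts (Suc r) P1 z (P2((e, r) := P1 (e, r))) c2"
      using inserts_upd_below[OF bump(5), of r e "P1 (e, r)"] by simp
    then show ?thesis
    proof (rule bump.IH[OF _ zy])
      show "w < x" if "Suc r \<le> s" "(P((c, r) \<mapsto> j)) (d, s) = Some x" "(P((c, r) \<mapsto> j)) (d, Suc s) = Some w"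
        for d s x w
        using bump.prems(3)[of s d x w] that by auto
      show "\<exists>x\<ge>w. (P((c, r) \<mapsto> j)) (b, s) = Some x" if "Suc r \<le> s" "1 \<le> b" "b < d" "(P((c, r) \<mapsto> j)) (d, s) = Some w"
        for b d s w
        using bump.prems(4)[of s b d w] that by auto
    qed
  qed
qed

section \<open>Row insertion in terms of column sets\<close>

lemma accepts_column_tableau:
  assumes "finite (C c)" "1 \<le> c" "1 \<le> r"
  shows "accepts j (column_tableau (\<le>) C (c, r)) \<longleftrightarrow> rank (\<le>) (C c) j < r"
proof (cases "column_tableau (\<le>) C (c, r)")
  case None
  then have "card (C c) < r"
    using decreasing.mem_dom_column_tableau[of C c r] assms by (auto simp: dom_def)
  moreover have "rank (\<le>) (C c) j \<le> card (C c)"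
    unfolding rank_def using assms by (intro card_mono) auto
  ultimately show ?thesis using None by (simp add: accepts_def)
next
  case (Some y)
  then have y: "y \<in> C c" "rank (\<le>) (C c) y = r"
    using decreasing.column_tableau_eq_Some[of C c r y] assms by auto
  show ?thesis
    using Some decreasing.rank_less[of "C c" y j] decreasing.rank_mono[of "C c" j y] assms(1) y
    by (cases "y < j") (auto simp: accepts_def)
qed

text \<open>As \<open>y\<close> is the largest entry below \<open>j\<close>, nothing lies strictly
  between them, so \<open>j\<close> takes over the row of \<open>y\<close> and all other entries
  keep theirs.\<close>

lemma column_tableau_replace:
  assumes fin: "\<And>c. finite (C c)" and c: "1 \<le> c" and j: "j \<notin> C c"
    and y: "y \<in> C c" "y < j" "\<And>x. x \<in> C c \<Longrightarrow> x < j \<Longrightarrow> x \<le> y"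
  shows "column_tableau (\<le>) (C(c := insert j (C c - {y}))) =
      (column_tableau (\<le>) C)((c, Suc (rank (\<le>) (C c) j)) \<mapsto> j)"
    and "column_tableau (\<le>) C (c, Suc (rank (\<le>) (C c) j)) = Some y"
proof -
  let ?D = "C(c := insert j (C c - {y}))"
  have fin': "finite (?D d)" for d using fin by simp
  have yr: "rank (\<le>) (C c) y = Suc (rank (\<le>) (C c) j)"
  proof -
    have "{x \<in> C c. y \<le> x} = insert y {x \<in> C c. j \<le> x}" using y by (auto simp: not_less) fastforce
    then show ?thesis using y fin by (simp add: rank_def)
  qed
  then show "column_tableau (\<le>) C (c, Suc (rank (\<le>) (C c) j)) = Some y"
    using decreasing.column_tableau_eq_Some[of C c] fin c y by simp
  have rank_j: "rank (\<le>) (insert j (C c - {y})) j = Suc (rank (\<le>) (C c) j)"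
  proof -
    have "{x \<in> insert j (C c - {y}). j \<le> x} = insert j {x \<in> C c. j \<le> x}" using y by auto
    then show ?thesis using j fin by (simp add: rank_def)
  qed
  have rank_x: "rank (\<le>) (insert j (C c - {y})) x = rank (\<le>) (C c) x" if x: "x \<in> C c" "x \<noteq> y" for x
  proof (cases "x < j")
    case True
    then have "x < y" using y(3)[of x] x by simp
    then have "{z \<in> insert j (C c - {y}). x \<le> z} = insert j ({z \<in> C c. x \<le> z} - {y})" using True by auto
    moreover have "Suc (card ({z \<in> C c. x \<le> z} - {y})) = card {z \<in> C c. x \<le> z}"
      using card_Suc_Diff1[of "{z \<in> C c. x \<le> z}" y] fin y \<open>x < y\<close> by simp
    ultimately show ?thesis using j fin by (simp add: rank_def)
  next
    case False
    then have "{z \<in> insert j (C c - {y}). x \<le> z} = {z \<in> C c. x \<le> z}" using j x y by auto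
    then show ?thesis by (simp add: rank_def)
  qed
  have *: "column_tableau (\<le>) ?D u = Some x \<longleftrightarrow>
    ((column_tableau (\<le>) C)((c, Suc (rank (\<le>) (C c) j)) \<mapsto> j)) u = Some x" for u x
  proof -
    obtain d r where u: "u = (d, r)" by (cases u)
    have "x = y" if "x \<in> C c" "rank (\<le>) (C c) x = Suc (rank (\<le>) (C c) j)"
      using decreasing.rank_inj[of "C c" x y] fin yr that y by simp
    then show ?thesis unfolding u decreasing.column_tableau_eq_Some[where C="?D", OF fin']
      using decreasing.column_tableau_eq_Some[OF fin] rank_j rank_x[of x] c j yr y(1,2) by auto
  qed
  show "column_tableau (\<le>) ?D =
      (column_tableau (\<le>) C)((c, Suc (rank (\<le>) (C c) j)) \<mapsto> j)"
  proof
    fix u show "column_tableau (\<le>) ?D u = ((column_tableau (\<le>) C)((c, Suc (rank (\<le>) (C c) j)) \<mapsto> j)) u"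
      using *[of u] by (metis not_None_eq)
  qed
qed

text \<open>The assumption \<open>left\<close> makes \<open>c\<close> the leftmost accepting column
  of row \<open>Suc (rank ...)\<close>. Since \<open>j\<close> is smaller than the whole column,
  that row is the first empty one.\<close>

lemma inserts_column_tableau_stop:
  assumes fin: "\<And>c. finite (C c)" and c: "1 \<le> c" and j: "\<And>x. x \<in> C c \<Longrightarrow> j < x"
    and left: "\<And>d. 1 \<le> d \<Longrightarrow> d < c \<Longrightarrow> rank (\<le>) (C c) j < rank (\<le>) (C d) j"
  shows "inserts (Suc (rank (\<le>) (C c) j)) (column_tableau (\<le>) C) j
    (column_tableau (\<le>) (C(c := insert j (C c)))) c"
proof -
  have "{x \<in> C c. j \<le> x} = C c" using j by fastforce
  then have rank: "rank (\<le>) (C c) j = card (C c)" by (simp add: rank_def)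
  have upd: "column_tableau (\<le>) (C(c := insert j (C c))) =
      (column_tableau (\<le>) C)((c, Suc (card (C c))) \<mapsto> j)"
    using decreasing.column_tableau_insert[of C c j] fin c j by fastforce
  show ?thesis unfolding upd rank
  proof (rule inserts.stop[OF c])
    show "\<not> accepts j (column_tableau (\<le>) C (d, Suc (card (C c))))" if "1 \<le> d" "d < c" for d
      using accepts_column_tableau[of C d "Suc (card (C c))" j] left[OF that] fin that rank by simp
    show "column_tableau (\<le>) C (c, Suc (card (C c))) = None"
      using decreasing.mem_dom_column_tableau[of C c "Suc (card (C c))"] fin by (auto simp: dom_def)
  qed
qed

lemma inserts_column_tableau_bump:
  assumes fin: "\<And>c. finite (C c)" and c: "1 \<le> c" and j: "j \<notin> C c"
    and y: "y \<in> C c" "y < j" "\<And>x. x \<in> C c \<Longrightarrow> x < j \<Longrightarrow> x \<le> y"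
    and left: "\<And>d. 1 \<le> d \<Longrightarrow> d < c \<Longrightarrow> rank (\<le>) (C c) j < rank (\<le>) (C d) j"
    and rest: "inserts (Suc (Suc (rank (\<le>) (C c) j))) (column_tableau (\<le>) (C(c := insert j (C c - {y})))) y P' e"
  shows "inserts (Suc (rank (\<le>) (C c) j)) (column_tableau (\<le>) C) j P' e"
proof (rule inserts.bump[OF c])
  show "\<not> accepts j (column_tableau (\<le>) C (d, Suc (rank (\<le>) (C c) j)))" if "1 \<le> d" "d < c" for d
    using accepts_column_tableau[of C d "Suc (rank (\<le>) (C c) j)" j] left[OF that] fin that by simp
  show "column_tableau (\<le>) C (c, Suc (rank (\<le>) (C c) j)) = Some y"
    by (rule column_tableau_replace(2)) (use fin c j y in auto)
  show "inserts (Suc (Suc (rank (\<le>) (C c) j)))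
      ((column_tableau (\<le>) C)((c, Suc (rank (\<le>) (C c) j)) \<mapsto> j)) y P' e"
    using rest column_tableau_replace(1)[of C c j y] fin c j y by simp
qed (fact y(2))

section \<open>Flagged insertion\<close>

definition entries :: "(nat \<Rightarrow> nat \<Rightarrow> nat) \<Rightarrow> nat \<Rightarrow> nat set" where
  "entries G c = G c ` {r. 0 < G c r}"

lemma (in skyline) finite_entries: "finite (entries G c)"
  by (simp add: entries_def finite_rows)

lemma (in skyline) rank_entries: "0 < j \<Longrightarrow> rank (\<le>) (entries G c) j = card {q. j \<le> G c q}"
proof -
  assume j: "0 < j"
  then have "{x \<in> entries G c. j \<le> x} = G c ` {q. j \<le> G c q}" by (auto simp: entries_def)
  moreover have "inj_on (G c) {q. j \<le> G c q}" using j col_inj[of c] by (intro inj_onI) auto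
  ultimately show ?thesis by (simp add: rank_def card_image)
qed

text \<open>Bumps and new cells are covered alike: for an empty cell the removed value is 0, which
  is never an entry.\<close>

lemma (in skyline) entries_upd:
  assumes "0 < j" "\<And>q. G e q \<noteq> j"
  shows "entries (G(e := (G e)(p := j))) = (entries G)(e := insert j (entries G e - {G e p}))"
proof
  fix c
  have "entries (G(e := (G e)(p := j))) e = insert j (entries G e - {G e p})"
    using assms col_inj[of e _ p] by (auto simp: entries_def)
  then show "entries (G(e := (G e)(p := j))) c = ((entries G)(e := insert j (entries G e - {G e p}))) c"
    by (simp add: entries_def)
qed

text \<open>One link of a chain of bumps. Ranks at thresholds up to \<open>y\<close> are unchanged,
  which keeps the comparison with the columns to the left valid when \<open>y\<close> is inserted
  next.\<close>

lemma inserts_column_tableau_bump_Max: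
  assumes fin: "\<And>c. finite (C c)" and c: "1 \<le> c" and j: "j \<notin> C c" and ex: "x \<in> C c" "x < j"
    and left: "\<And>d. 1 \<le> d \<Longrightarrow> d < c \<Longrightarrow> rank (\<le>) (C c) j < rank (\<le>) (C d) j"
  obtains y where "y \<in> C c" "x \<le> y" "y < j"
    "\<And>w. w \<le> y \<Longrightarrow> rank (\<le>) (insert j (C c - {y})) w = rank (\<le>) (C c) w"
    "\<And>P e. inserts (Suc (rank (\<le>) (insert j (C c - {y})) y))
      (column_tableau (\<le>) (C(c := insert j (C c - {y})))) y P e \<Longrightarrow>
      inserts (Suc (rank (\<le>) (C c) j)) (column_tableau (\<le>) C) j P e"
proof -
  define y where "y = Max {x \<in> C c. x < j}"
  have finA: "finite {x \<in> C c. x < j}" using fin by simp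
  have "y \<in> {x \<in> C c. x < j}" unfolding y_def by (rule Max_in[OF finA]) (use ex in blast)
  then have y: "y \<in> C c" "y < j" by auto
  have ymax: "z \<le> y" if "z \<in> C c" "z < j" for z
    unfolding y_def using finA that by (intro Max_ge) auto
  have rank: "rank (\<le>) (insert j (C c - {y})) y = Suc (rank (\<le>) (C c) j)"
  proof -
    have "{z \<in> insert j (C c - {y}). y \<le> z} = insert j {z \<in> C c. j \<le> z}"
      using y ymax by (auto simp: not_less) (meson leD leI order_antisym)
    then show ?thesis using fin j by (simp add: rank_def)
  qed
  show ?thesis
  proof (rule that[OF y(1) ymax[OF ex] y(2)])
    fix w assume w: "w \<le> y"
    have "{z \<in> insert j (C c - {y}). w \<le> z} = insert j ({z \<in> C c. w \<le> z} - {y})" using w y by auto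
    moreover have "Suc (card ({z \<in> C c. w \<le> z} - {y})) = card {z \<in> C c. w \<le> z}"
      using card_Suc_Diff1[of "{z \<in> C c. w \<le> z}" y] fin y w by simp
    ultimately show "rank (\<le>) (insert j (C c - {y})) w = rank (\<le>) (C c) w"
      using fin j by (simp add: rank_def)
  next
    fix P e
    assume "inserts (Suc (rank (\<le>) (insert j (C c - {y})) y))
      (column_tableau (\<le>) (C(c := insert j (C c - {y})))) y P e"
    then show "inserts (Suc (rank (\<le>) (C c) j)) (column_tableau (\<le>) C) j P e"
      using inserts_column_tableau_bump[of C c j y P e] fin c j y ymax left rank by simp
  qed
qed

text \<open>
  A single replacement of the flagged insertion may skip entries of the column.  Row insertion
  bumps these one after the other, all within this column because by assumption \<open>left\<close> the
  column is shorter than its predecessors also when only the entries at least \<open>y\<close> are counted.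
\<close>

lemma inserts_column_tableau_chain:
  assumes fin: "\<And>c. finite (C c)" and c: "1 \<le> c" and j: "j \<notin> C c" and z: "z \<in> C c" "z < j"
    and left: "\<And>d y. 1 \<le> d \<Longrightarrow> d < c \<Longrightarrow> z < y \<Longrightarrow> y \<le> j \<Longrightarrow> rank (\<le>) (C c) y < rank (\<le>) (C d) y"
    and rest: "inserts (Suc (rank (\<le>) (insert j (C c - {z})) z))
      (column_tableau (\<le>) (C(c := insert j (C c - {z})))) z P e"
  shows "inserts (Suc (rank (\<le>) (C c) j)) (column_tableau (\<le>) C) j P e"
  using fin j z left rest
proof (induction j arbitrary: C rule: less_induct)
  case (less j C)
  have l: "rank (\<le>) (C c) j < rank (\<le>) (C d) j" if "1 \<le> d" "d < c" for d
    using less.prems(4,5) that by simp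
  obtain y where y: "y \<in> C c" "z \<le> y" "y < j"
    and rank: "\<And>w. w \<le> y \<Longrightarrow> rank (\<le>) (insert j (C c - {y})) w = rank (\<le>) (C c) w"
    and step: "\<And>P e. inserts (Suc (rank (\<le>) (insert j (C c - {y})) y))
        (column_tableau (\<le>) (C(c := insert j (C c - {y})))) y P e \<Longrightarrow>
      inserts (Suc (rank (\<le>) (C c) j)) (column_tableau (\<le>) C) j P e"
    by (rule inserts_column_tableau_bump_Max[of C c j z, OF less.prems(1) c less.prems(2-4) l]) (assumption | rule that; blast)+
  show ?case
  proof (cases "y = z")
    case True
    then show ?thesis using step less.prems(6) by (simp add: fun_upd_def)
  next
    case False
    let ?C = "C(c := insert j (C c - {y}))"
    have "inserts (Suc (rank (\<le>) (?C c) y)) (column_tableau (\<le>) ?C) y P e"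
    proof (rule less.IH[OF y(3)])
      show "rank (\<le>) (?C c) w < rank (\<le>) (?C d) w" if "1 \<le> d" "d < c" "z < w" "w \<le> y" for d w
        using less.prems(5)[of d w] that y rank by simp
      \<comment> \<open>Replacing \<open>y\<close> by \<open>j\<close> and then \<open>z\<close> by
        \<open>y\<close> has the net effect of replacing \<open>z\<close> by
        \<open>j\<close>.\<close>
      have eq: "insert y (?C c - {z}) = insert j (C c - {z})" using y less.prems(4) False by auto
      have "rank (\<le>) (insert j (C c - {z})) z = rank (\<le>) (insert y (?C c - {z})) z" by (simp only: eq)
      moreover have "?C(c := insert y (?C c - {z})) = C(c := insert j (C c - {z}))"
        by (simp only: eq fun_upd_upd)
      ultimately show "inserts (Suc (rank (\<le>) (insert y (?C c - {z})) z))
          (column_tableau (\<le>) (?C(c := insert y (?C c - {z})))) z P e"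
        using less.prems(6) by (simp only:)
    qed (use y False less.prems in auto)
    then show ?thesis using step by simp
  qed
qed

text \<open>The counterpart for a flagged insertion that fills an empty cell, with 0 in the role of
  \<open>z\<close>: all entries below \<open>j\<close> are bumped in turn within the column, and the
  smallest ends in a new top cell.\<close>

lemma inserts_column_tableau_chain_stop:
  assumes fin: "\<And>c. finite (C c)" and c: "1 \<le> c" and j: "j \<notin> C c" "0 < j" and pos: "0 \<notin> C c"
    and left: "\<And>d y. 1 \<le> d \<Longrightarrow> d < c \<Longrightarrow> 0 < y \<Longrightarrow> y \<le> j \<Longrightarrow> rank (\<le>) (C c) y < rank (\<le>) (C d) y"
  shows "inserts (Suc (rank (\<le>) (C c) j)) (column_tableau (\<le>) C) j
    (column_tableau (\<le>) (C(c := insert j (C c)))) c"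
  using fin j pos left
proof (induction j arbitrary: C rule: less_induct)
  case (less j C)
  show ?case
  proof (cases "\<exists>x \<in> C c. x < j")
    case False
    then have "j < x" if "x \<in> C c" for x using less.prems(2) that by (metis linorder_neqE_nat)
    then show ?thesis using less.prems c by (intro inserts_column_tableau_stop) auto
  next
    case True
    then obtain x where x: "x \<in> C c" "x < j" by blast
    have l: "rank (\<le>) (C c) j < rank (\<le>) (C d) j" if "1 \<le> d" "d < c" for d
      using less.prems(3,5) that by simp
    obtain y where y: "y \<in> C c" "x \<le> y" "y < j"
      and rank: "\<And>w. w \<le> y \<Longrightarrow> rank (\<le>) (insert j (C c - {y})) w = rank (\<le>) (C c) w"
      and step: "\<And>P e. inserts (Suc (rank (\<le>) (insert j (C c - {y})) y))
          (column_tableau (\<le>) (C(c := insert j (C c - {y})))) y P e \<Longrightarrow>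
        inserts (Suc (rank (\<le>) (C c) j)) (column_tableau (\<le>) C) j P e"
      by (rule inserts_column_tableau_bump_Max[of C c j x, OF less.prems(1) c less.prems(2) x l]) (assumption | rule that; blast)+
    have "0 < y" using y(1) less.prems(4) by (cases y) auto
    let ?C = "C(c := insert j (C c - {y}))"
    have "inserts (Suc (rank (\<le>) (?C c) y)) (column_tableau (\<le>) ?C) y
        (column_tableau (\<le>) (?C(c := insert y (?C c)))) c"
    proof (rule less.IH[OF y(3)])
      show "rank (\<le>) (?C c) w < rank (\<le>) (?C d) w" if "1 \<le> d" "d < c" "0 < w" "w \<le> y" for d w
        using less.prems(5)[of d w] that y rank by simp
    qed (use y \<open>0 < y\<close> less.prems in auto)
    moreover have eq: "insert y (?C c) = insert j (C c)" using y by auto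
    have "?C(c := insert y (?C c)) = C(c := insert j (C c))" by (simp only: eq fun_upd_upd)
    ultimately have "inserts (Suc (rank (\<le>) (insert j (C c - {y})) y)) (column_tableau (\<le>) ?C) y
        (column_tableau (\<le>) (C(c := insert j (C c)))) c"
      by (simp only:) (simp only: fun_upd_same)
    then show ?thesis by (rule step)
  qed
qed

text \<open>The last clause says that the new cell is the topmost available one of its column; it
  supplies the assumption \<open>top\<close> of \<open>atom_skyline_add\<close>.\<close>

definition grows :: "(nat \<Rightarrow> nat \<Rightarrow> nat) \<Rightarrow> (nat \<Rightarrow> nat \<Rightarrow> nat) \<Rightarrow> nat \<Rightarrow> nat \<Rightarrow> bool" where
  "grows G G' d p \<longleftrightarrow> 1 \<le> d \<and> G d p = 0 \<and> 0 < G (d - 1) p \<and> 0 < G' d p \<and>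
     (\<forall>e q. (e, q) \<noteq> (d, p) \<longrightarrow> (0 < G' e q \<longleftrightarrow> 0 < G e q)) \<and>
     (\<forall>q>p. 0 < G (d - 1) q \<longrightarrow> 0 < G d q)"

lemma (in skyline) count_ge_filling_of:
  "0 < j \<Longrightarrow> count_ge n (filling_of G) j c = card {q. j \<le> G c q}"
  unfolding count_ge_def augment_filling_of by (rule arg_cong[of _ _ card]) auto

lemma (in skyline) insertion_rows_filling_of:
  "0 < j \<Longrightarrow> 1 \<le> e \<Longrightarrow> insertion_rows n (filling_of G) e j = {s. j \<le> G (e - 1) s \<and> G e s < j}"
  unfolding insertion_rows_def augment_filling_of
  by (auto simp: filling_of_def accepts_def)

lemma filling_of_upd:
  "1 \<le> e \<Longrightarrow> 0 < j \<Longrightarrow> filling_of (G(e := (G e)(p := j))) = (filling_of G)((e, p) \<mapsto> j)"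
  by (auto simp: filling_of_def fun_eq_iff)

text \<open>
  The assumptions \<open>below\<close> and \<open>above\<close> on the row \<open>r\<close> from which \<open>j\<close> was bumped matter when \<open>j\<close>
  reenters its own column \<open>c\<close>: then it lands in row \<open>r\<close> or below.  In an earlier column the equality
  of the numbers of entries that are at least \<open>j\<close> plays their role.
\<close>

lemma flagged_insert_from_key_skyline:
  assumes "key_skyline n G" and j: "1 \<le> j" "j \<le> n" and c: "1 \<le> c" and notin: "\<And>q. G c q \<noteq> j"
    and below: "\<And>q. q < r \<Longrightarrow> j < G c q \<Longrightarrow> j < G (Suc c) q"
    and above: "\<And>s. r < s \<Longrightarrow> j \<le> G (c - 1) s \<Longrightarrow> j \<le> G c s"
  shows "\<exists>G' d p. flagged_insert_from n (enat c) (filling_of G) j = Some (filling_of G') \<and>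
    key_skyline n G' \<and> grows G G' d p \<and>
    inserts (Suc (rank (\<le>) (entries G c) j)) (column_tableau (\<le>) (entries G)) j
      (column_tableau (\<le>) (entries G')) d"
  using assms
proof (induction j arbitrary: G c r rule: less_induct)
  case (less j G c r)
  interpret key_skyline n G by fact
  note j = less.prems(2,3) and c = less.prems(4) and notin = less.prems(5)
    and below = less.prems(6) and above = less.prems(7)
  define cnt where "cnt e = card {q. j \<le> G e q}" for e
  have cnt_anti: "cnt e \<le> cnt d" if "d \<le> e" for d e
    unfolding cnt_def using that j row_mono[OF that] finite_ge[of j d]
    by (intro card_mono) (auto intro: le_trans)
  define K where "K = {e. 1 \<le> e \<and> e \<le> c \<and> cnt e < cnt (e - 1)}"
  have K: "insertion_columns n (filling_of G) (enat c) j = K"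
    using j by (auto simp: insertion_columns_def K_def cnt_def count_ge_filling_of)
  have finK: "finite K" by (rule finite_subset[of _ "{..c}"]) (auto simp: K_def)
  have cnt_step: "cnt d = cnt d'" if "d \<le> d'" "d' \<le> c" "\<And>e. d < e \<Longrightarrow> e \<le> c \<Longrightarrow> e \<notin> K" for d d'
    using that(1,2)
  proof (induction d' rule: dec_induct)
    case (step m)
    then show ?case using that(3)[of "Suc m"] cnt_anti[of m "Suc m"] by (auto simp: K_def)
  qed simp
  \<comment> \<open>Without a drop, column \<open>c\<close> would contain as many entries that are
    at least \<open>j\<close> as the basement, namely all of \<open>j\<close> to \<open>n\<close>;
    but it avoids \<open>j\<close>.\<close>
  have "K \<noteq> {}"
  proof
    assume "K = {}"
    then have "cnt 0 = cnt c" using cnt_step[of 0 c] by simp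
    moreover have "cnt 0 = card {j..n}"
      unfolding cnt_def using j by (intro arg_cong[of _ _ card]) (auto simp: base basement_def split: if_splits)
    moreover have "cnt c = card (G c ` {q. j \<le> G c q})"
      unfolding cnt_def using j col_inj[of c] by (intro card_image[symmetric] inj_onI) auto
    moreover have "card (G c ` {q. j \<le> G c q}) \<le> card {Suc j..n}"
    proof (intro card_mono subsetI)
      fix x assume "x \<in> G c ` {q. j \<le> G c q}"
      then show "x \<in> {Suc j..n}" using notin le by (auto simp: Suc_le_eq) (metis le_neq_implies_less)
    qed simp
    ultimately show False using j by simp
  qed
  define e where "e = Max K"
  have "e \<in> K" unfolding e_def using finK \<open>K \<noteq> {}\<close> by (rule Max_in)
  then have e: "1 \<le> e" "e \<le> c" "cnt e < cnt (e - 1)" by (auto simp: K_def)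
  have eK: "m \<notin> K" if "e < m" for m
    using that finK by (metis Max_ge e_def not_le)
  have largest_K: "largest K = Some e" using finK \<open>K \<noteq> {}\<close> by (simp add: largest_def e_def)
  have cnt_eq: "cnt d = cnt c" if "e \<le> d" "d \<le> c" for d
    using cnt_step[of d c] eK that by simp
  \<comment> \<open>There is no drop after \<open>e\<close>, so the counts agree from
    \<open>e\<close> to \<open>c\<close>; as rows decrease, the sets of rows are nested and hence
    equal.\<close>
  have ge_iff: "j \<le> G d q \<longleftrightarrow> j \<le> G c q" if "e \<le> d" "d \<le> c" for d q
  proof -
    have "{q. j \<le> G c q} = {q. j \<le> G d q}"
    proof (rule card_subset_eq)
      show "finite {q. j \<le> G d q}" using finite_ge j by simp
      show "{q. j \<le> G c q} \<subseteq> {q. j \<le> G d q}" using row_mono[OF that(2)] by (auto intro: le_trans)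
      show "card {q. j \<le> G c q} = card {q. j \<le> G d q}" using cnt_eq[OF that] by (simp add: cnt_def)
    qed
    then show ?thesis by blast
  qed
  have notin': "G d q \<noteq> j" if "e \<le> d" "d \<le> c" for d q
  proof
    assume "G d q = j"
    moreover have "j \<le> G c q" using ge_iff[OF that, of q] \<open>G d q = j\<close> by simp
    ultimately show False using row_mono[OF that(2), of q] notin[of q] by simp
  qed
  define K2 where "K2 = {s. j \<le> G (e - 1) s \<and> G e s < j}"
  have K2: "insertion_rows n (filling_of G) e j = K2"
    using insertion_rows_filling_of e j by (simp add: K2_def)
  have finK2: "finite K2"
    by (rule finite_subset[OF _ finite_ge[of j "e - 1"]]) (use j in \<open>auto simp: K2_def\<close>)
  have "K2 \<noteq> {}"
  proof
    assume "K2 = {}"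
    then have "{q. j \<le> G (e - 1) q} \<subseteq> {q. j \<le> G e q}" by (auto simp: K2_def not_less)
    then have "cnt (e - 1) \<le> cnt e" unfolding cnt_def using finite_ge[of j e] j by (intro card_mono) auto
    then show False using e by simp
  qed
  define p where "p = Max K2"
  have "p \<in> K2" unfolding p_def using finK2 \<open>K2 \<noteq> {}\<close> by (rule Max_in)
  then have p: "j \<le> G (e - 1) p" "G e p < j" by (auto simp: K2_def)
  have largest_K2: "largest K2 = Some p" using finK2 \<open>K2 \<noteq> {}\<close> by (simp add: largest_def p_def)
  have top: "j \<le> G e s" if "p < s" "j \<le> G (e - 1) s" for s
    using that finK2 Max_ge[of K2 s] by (fastforce simp: p_def K2_def)
  \<comment> \<open>A higher row whose entry in column \<open>e - 1\<close> is below
    \<open>j\<close> is behind row \<open>p\<close> there, so by \<open>key\<close> it is also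
    behind the old entry of \<open>(e, p)\<close>. If that cell is empty, no such row
    exists.\<close>
  have low: "G (e - 1) s < G e p" if "p < s" "G (e - 1) s < j" "0 < G (e - 1) s" for s
    using key[of p s "e - 1"] that p e by simp
  have below': "j < G (Suc e) q" if q: "q < p" "j < G e q" for q
  proof (cases "e = c")
    case True
    have "p \<le> r" using above[of p] p True by (cases "p \<le> r") auto
    then show ?thesis using below[of q] q True by simp
  next
    case False
    then have "j \<le> G (Suc e) q" using ge_iff[of e q] ge_iff[of "Suc e" q] e q by simp
    moreover have "G (Suc e) q \<noteq> j" using notin'[of "Suc e" q] False e by simp
    ultimately show ?thesis by simp
  qed
  define G1 where "G1 = G(e := (G e)(p := j))"
  have key1: "key_skyline n G1" unfolding G1_def
    by (rule key_skyline_replace) (use key_skyline_axioms e j p notin'[of e] top below' in auto)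
  interpret G1: key_skyline n G1 by (fact key1)
  have fill1: "filling_of G1 = (filling_of G)((e, p) \<mapsto> j)"
    unfolding G1_def using e j by (intro filling_of_upd) auto
  have ent1: "entries G1 = (entries G)(e := insert j (entries G e - {G e p}))"
    unfolding G1_def by (rule entries_upd) (use j notin'[of e] e in auto)
  have rank: "rank (\<le>) (entries G c) j = rank (\<le>) (entries G e) j"
    using rank_entries[of j c] rank_entries[of j e] cnt_eq[of e] e j by (simp add: cnt_def)
  have j_ent: "j \<notin> entries G e" using notin'[of e] e by (auto simp: entries_def)
  have left: "rank (\<le>) (entries G e) y < rank (\<le>) (entries G d) y"
    if "1 \<le> d" "d < e" "G e p < y" "y \<le> j" for d y
  proof -
    have "{q. y \<le> G e q} \<subset> {q. y \<le> G d q}"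
    proof
      show "{q. y \<le> G e q} \<subseteq> {q. y \<le> G d q}" using row_mono[of d e] that by (auto intro: le_trans)
      \<comment> \<open>Row \<open>p\<close> makes the inclusion strict: its entry in column
        \<open>d\<close> is at least \<open>j\<close>, but in column \<open>e\<close> it is below
        \<open>y\<close>.\<close>
      have "y \<le> G d p" using row_mono[of d "e - 1" p] p that by linarith
      then show "{q. y \<le> G e q} \<noteq> {q. y \<le> G d q}" using that(3) by (auto simp: set_eq_iff not_le[symmetric])
    qed
    then show ?thesis using rank_entries[of y] that finite_ge[of y d] by (simp add: psubset_card_mono)
  qed
  show ?case
  proof (cases "G e p = 0")
    case True
    have "flagged_insert_from n (enat c) (filling_of G) j = Some (filling_of G1)"
      by (subst flagged_insert_from.simps)
        (use True filling_of_eq_None[of G e p] in \<open>simp add: K K2 largest_K largest_K2 fill1\<close>)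
    moreover have "grows G G1 e p"
      unfolding grows_def
    proof (intro conjI allI impI)
      show "0 < G e q" if "p < q" "0 < G (e - 1) q" for q
        using top[of q] low[of q] that True j by (cases "j \<le> G (e - 1) q") auto
    qed (use e True p j in \<open>auto simp: G1_def\<close>)
    moreover have "inserts (Suc (rank (\<le>) (entries G c) j)) (column_tableau (\<le>) (entries G)) j
      (column_tableau (\<le>) (entries G1)) e"
    proof -
      have "entries G e - {G e p} = entries G e" using True by (auto simp: entries_def)
      moreover have "0 \<notin> entries G e" by (auto simp: entries_def)
      ultimately show ?thesis unfolding rank ent1
        using inserts_column_tableau_chain_stop[of "entries G" e j] finite_entries e j j_ent left True
        by simp
    qed
    ultimately show ?thesis using key1 by blast
  next
    case False
    let ?z = "G e p"
    have "\<exists>G' d p'. flagged_insert_from n (enat e) (filling_of G1) ?z = Some (filling_of G') \<and>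
      key_skyline n G' \<and> grows G1 G' d p' \<and>
      inserts (Suc (rank (\<le>) (entries G1 e) ?z)) (column_tableau (\<le>) (entries G1)) ?z
        (column_tableau (\<le>) (entries G')) d"
    \<comment> \<open>Row \<open>p\<close> takes the role of \<open>r\<close> for the bumped entry:
      \<open>below\<close> is \<open>key\<close> for the old filling, and \<open>above\<close>
      combines \<open>top\<close> with \<open>low\<close>.\<close>
    proof (rule less.IH[OF p(2) key1])
      show "1 \<le> ?z" "?z \<le> n" "1 \<le> e" using False le e by auto
      show "G1 e q \<noteq> ?z" for q using col_inj[of e q p] p False by (auto simp: G1_def)
      show "?z < G1 (Suc e) q" if "q < p" "?z < G1 e q" for q
        using key[of q p e] that False by (auto simp: G1_def)
      show "?z \<le> G1 e s" if "p < s" "?z \<le> G1 (e - 1) s" for s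
      proof -
        have "G1 (e - 1) s = G (e - 1) s" "G1 e s = G e s" using e(1) that(1) by (auto simp: G1_def)
        then show ?thesis using top[of s] low[of s] that p False by (cases "j \<le> G (e - 1) s") auto
      qed
    qed
    then obtain G' d p' where
      run: "flagged_insert_from n (enat e) (filling_of G1) ?z = Some (filling_of G')" and
      key': "key_skyline n G'" and grow: "grows G1 G' d p'" and
      ins: "inserts (Suc (rank (\<le>) (entries G1 e) ?z)) (column_tableau (\<le>) (entries G1)) ?z
        (column_tableau (\<le>) (entries G')) d"
      by blast
    have "flagged_insert_from n (enat c) (filling_of G) j = Some (filling_of G')"
      by (subst flagged_insert_from.simps)
        (use False e run filling_of_eq_Some[of G e p ?z] in \<open>simp add: K K2 largest_K largest_K2 fill1\<close>)
    moreover have "grows G G' d p'"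
    proof -
      have pos1: "0 < G1 a b \<longleftrightarrow> 0 < G a b" for a b using False j by (auto simp: G1_def)
      have "G1 a b = 0 \<longleftrightarrow> G a b = 0" for a b using pos1[of a b] by auto
      then show ?thesis using grow pos1 unfolding grows_def by simp
    qed
    moreover have "inserts (Suc (rank (\<le>) (entries G c) j)) (column_tableau (\<le>) (entries G)) j
      (column_tableau (\<le>) (entries G')) d"
      unfolding rank
    proof (rule inserts_column_tableau_chain[where c=e and z="?z"])
      show "?z \<in> entries G e" using False by (auto simp: entries_def)
      show "inserts (Suc (rank (\<le>) (insert j (entries G e - {?z})) ?z))
          (column_tableau (\<le>) ((entries G)(e := insert j (entries G e - {?z})))) ?z
          (column_tableau (\<le>) (entries G')) d"
        using ins unfolding ent1 by simp
    qed (use finite_entries e j_ent p left in auto)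
    ultimately show ?thesis using key' by blast
  qed
qed

lemma flagged_insert_key_skyline:
  assumes "key_skyline n G" and j: "1 \<le> j" "j \<le> n"
  shows "\<exists>G' d p. flagged_insert n (filling_of G) j = Some (filling_of G') \<and>
    key_skyline n G' \<and> grows G G' d p \<and>
    inserts 1 (column_tableau (\<le>) (entries G)) j (column_tableau (\<le>) (entries G')) d"
proof -
  interpret key_skyline n G by fact
  obtain M where M: "2 \<le> M" "\<forall>r. G M r = 0" using bounded_ge by blast
  have zero: "G e q = 0" if "M \<le> e" for e q using pos_mono[of e q M] M that by auto
  \<comment> \<open>Columns \<open>c - 1\<close> and \<open>c\<close> are both empty, so the
    assumptions \<open>below\<close> and \<open>above\<close> hold vacuously for any starting row,
    and the rank of \<open>j\<close> is 0, which makes row insertion start in row 1.\<close>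
  define c where "c = Suc M"
  have "insertion_columns n (filling_of G) \<infinity> j = insertion_columns n (filling_of G) (enat c) j"
  proof -
    have "e \<le> c" if "card {q. j \<le> G e q} < card {q. j \<le> G (e - 1) q}" for e
    proof (rule ccontr)
      assume "\<not> e \<le> c"
      then have "{q. j \<le> G (e - 1) q} = {}" using zero[of "e - 1"] j by (auto simp: c_def)
      then show False using that by simp
    qed
    then show ?thesis using j by (auto simp: insertion_columns_def count_ge_filling_of)
  qed
  then have run: "flagged_insert_from n \<infinity> (filling_of G) j = flagged_insert_from n (enat c) (filling_of G) j"
    by (subst (1 2) flagged_insert_from.simps) simp
  have rank: "rank (\<le>) (entries G c) j = 0"
    using zero[of c] by (simp add: entries_def rank_def c_def)
  have "\<exists>G' d p. flagged_insert_from n (enat c) (filling_of G) j = Some (filling_of G') \<and>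
    key_skyline n G' \<and> grows G G' d p \<and>
    inserts (Suc (rank (\<le>) (entries G c) j)) (column_tableau (\<le>) (entries G)) j
      (column_tableau (\<le>) (entries G')) d"
    by (rule flagged_insert_from_key_skyline[where r=n]) (use assms zero[of c] zero[of "c - 1"] in \<open>auto simp: c_def\<close>)
  then show ?thesis using run SSKT j rank by (simp add: flagged_insert_def)
qed

section \<open>Flagged RSK\<close>

context skyline
begin

lemma card_entries: "card (entries G c) = card {r. 0 < G c r}"
  unfolding entries_def using col_inj[of c] by (intro card_image inj_onI) auto

lemma card_entries_Suc: "card (entries G (Suc c)) \<le> card (entries G c)"
  unfolding card_entries using left_pos by (intro card_mono finite_rows) auto

lemma entries_empty: "\<exists>M\<ge>1. entries G M = {}"
  using bounded_ge[of 1] by (auto simp: entries_def)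

lemma entries_range: "entries G c \<subseteq> {1..n}"
  using le by (auto simp: entries_def)

end

lemma (in key_skyline) interlaced_entries: "interlaced (\<le>) (entries G)"
proof
  fix c x
  show "rank (\<le>) (entries G (Suc c)) x \<le> rank (\<le>) (entries G c) x"
  \<comment> \<open>The threshold 0 is separate because counting rows with entry at least 0 would
    include the empty cells.\<close>
  proof (cases "x = 0")
    case True
    then show ?thesis using card_entries_Suc by (simp add: rank_def)
  next
    case False
    then have x: "0 < x" by simp
    have "{q. x \<le> G (Suc c) q} \<subseteq> {q. x \<le> G c q}" using row le_trans by blast
    then show ?thesis unfolding rank_entries[OF x] by (rule card_mono[OF finite_ge[OF x]])
  qed
qed (use finite_entries card_entries_Suc entries_empty in auto)

lemma (in atom_skyline) interlaced_entries: "interlaced (\<ge>) (entries G)"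
proof
  fix c x
  have rank: "rank (\<ge>) (entries G c) x = card {q. 0 < G c q \<and> G c q \<le> x}" for c
  proof -
    have "{y \<in> entries G c. y \<le> x} = G c ` {q. 0 < G c q \<and> G c q \<le> x}" by (auto simp: entries_def)
    moreover have "inj_on (G c) {q. 0 < G c q \<and> G c q \<le> x}" using col_inj[of c] by (intro inj_onI) auto
    ultimately show ?thesis by (simp add: rank_def card_image)
  qed
  have "{q. 0 < G (Suc c) q \<and> G (Suc c) q \<le> x} \<subseteq> {q. 0 < G c q \<and> G c q \<le> x}"
    using left_pos[of c] row[of c] by (auto intro: le_trans)
  moreover have "finite {q. 0 < G c q \<and> G c q \<le> x}"
    by (rule finite_subset[OF _ finite_rows[of c]]) auto
  ultimately show "rank (\<ge>) (entries G (Suc c)) x \<le> rank (\<ge>) (entries G c) x"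
    unfolding rank by (intro card_mono)
qed (use finite_entries card_entries_Suc entries_empty in auto)

lemma (in interlaced) row_left:
  assumes "1 \<le> c" "c < d" "column_tableau R C (d, r) = Some y"
  shows "\<exists>x. R y x \<and> column_tableau R C (c, r) = Some x"
proof -
  have "1 \<le> r" "r \<le> card (C d)" using mem_dom_column_tableau[of C d r] fin assms(3) by auto
  then have "(c, r) \<in> dom (column_tableau R C)"
    using mem_dom_column_tableau[of C c r] fin card_antimono[of c d] assms by simp
  then obtain x where "column_tableau R C (c, r) = Some x" by blast
  then show ?thesis using row_weak[OF assms(2) _ assms(3)] by blast
qed

text \<open>The inclusion of key fillings for \<open>m\<close> in those for \<open>n\<close>.
  Basement entries increase with the row, so \<open>key\<close> is vacuous in column 0, and the
  added rows are empty from column 1 on.\<close>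

lemma key_skyline_basement:
  assumes "key_skyline m G" "m \<le> n"
  shows "key_skyline n (G(0 := basement n))"
proof -
  interpret key_skyline m G by fact
  obtain M where M: "1 \<le> M" "\<forall>r. G M r = 0" using bounded_ge by blast
  have b: "G 0 r \<le> basement n r" for r using assms(2) by (simp add: base basement_def)
  show ?thesis
  proof
    show "0 < (G(0 := basement n)) c r" if "0 < (G(0 := basement n)) (Suc c) r" for c r
      using left_pos[of c r] that b[of r] by (cases c) auto
    show "\<exists>M. \<forall>r. (G(0 := basement n)) M r = 0" using M by (intro exI[of _ M]) auto
    show "r = s" if "(G(0 := basement n)) c r = (G(0 := basement n)) c s" "0 < (G(0 := basement n)) c r" for c r s
      using that col_inj[of c r s] by (auto simp: basement_def split: if_splits)
    show "(G(0 := basement n)) c r \<le> n" for c r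
      using le[of c r] assms(2) by (auto simp: basement_def)
    show "(G(0 := basement n)) (Suc c) r \<le> (G(0 := basement n)) c r" for c r
      using row[of c r] b[of r] by (cases c) auto
    show "(G(0 := basement n)) c s < (G(0 := basement n)) (Suc c) r"
      if "r < s" "(G(0 := basement n)) c s < (G(0 := basement n)) c r" "0 < (G(0 := basement n)) c s" for c r s
      using that key[of r s c] by (cases "c = 0") (auto simp: basement_def split: if_splits)
  qed simp
qed

lemma filling_of_basement: "filling_of (G(0 := b)) = filling_of G"
  by (auto simp: filling_of_def fun_eq_iff)

lemma column_tableau_entries_basement: "column_tableau R (entries (G(0 := b))) = column_tableau R (entries G)"
  by (auto simp: column_tableau_def entries_def fun_eq_iff)

definition empty_skyline :: "nat \<Rightarrow> nat \<Rightarrow> nat \<Rightarrow> nat" where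
  "empty_skyline n c r = (if c = 0 then basement n r else 0)"

lemma filling_of_empty_skyline: "filling_of (empty_skyline n) = Map.empty"
  by (auto simp: filling_of_def empty_skyline_def fun_eq_iff)

lemma column_tableau_empty_skyline: "column_tableau R (entries (empty_skyline n)) = Map.empty"
  by (auto simp: column_tableau_def entries_def empty_skyline_def fun_eq_iff)

lemma skyline_empty: "skyline n (empty_skyline n)"
proof
  show "empty_skyline n 0 = basement n" by (simp add: fun_eq_iff empty_skyline_def)
  show "\<exists>M. \<forall>r. empty_skyline n M r = 0" by (intro exI[of _ 1]) (simp add: empty_skyline_def)
qed (auto simp: empty_skyline_def basement_def split: if_splits)

lemma key_skyline_empty: "key_skyline n (empty_skyline n)"
proof -
  interpret skyline n "empty_skyline n" by (rule skyline_empty)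
  show ?thesis by unfold_locales (auto simp: empty_skyline_def basement_def split: if_splits)
qed

lemma atom_skyline_empty: "atom_skyline n (empty_skyline n)"
proof -
  interpret skyline n "empty_skyline n" by (rule skyline_empty)
  show ?thesis by unfold_locales (auto simp: empty_skyline_def basement_def split: if_splits)
qed

section \<open>Induction along the biword\<close>

definition biword_less :: "nat \<times> nat \<Rightarrow> nat \<times> nat \<Rightarrow> bool" where
  "biword_less a b \<longleftrightarrow> fst a < fst b \<or> fst a = fst b \<and> snd b \<le> snd a"

lemma sorted_biword: "sorted_wrt biword_less (biword n A)"
proof -
  define js where "js = rev [1..<Suc n]"
  have js: "sorted_wrt (>) js" by (simp add: js_def sorted_wrt_rev sorted_wrt_upt del: upt_Suc)
  have inner: "sorted_wrt biword_less (concat (map (\<lambda>j. replicate (A i j) (i, j)) js))" for i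
    using js
  proof (induction js)
    case (Cons j js)
    have "sorted_wrt biword_less (replicate k (i, j))" for k
      by (induction k) (auto simp: biword_less_def)
    then show ?case using Cons by (auto simp: sorted_wrt_append) (auto simp: biword_less_def)
  qed simp
  have "sorted_wrt biword_less (concat (concat (map (\<lambda>i. map (\<lambda>j. replicate (A i j) (i, j)) js) is)))"
    if "sorted_wrt (<) is" for "is"
    using that
  proof (induction "is")
    case (Cons i "is")
    then show ?case using inner[of i] by (auto simp: sorted_wrt_append) (auto simp: biword_less_def)
  qed simp
  from this[OF sorted_wrt_upt] show ?thesis by (simp only: biword_def js_def)
qed

lemma set_biword_lower:
  assumes "L \<in> lower_matrices n" "(i, j) \<in> set (biword n L)"
  shows "1 \<le> j \<and> j \<le> i \<and> i \<le> n"
proof -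
  have "L i j \<noteq> 0" "1 \<le> j" "i \<le> n" using assms(2) by (auto simp: biword_def)
  moreover have "L i j = 0" if "i < j" using assms(1) that by (simp add: lower_matrices_def)
  ultimately show ?thesis by (metis not_le)
qed

text \<open>
  The last clause keeps enough information on the last letter to compare its new cell with the
  next one by the row bumping lemma.
\<close>

definition fRSK_state :: "nat \<Rightarrow> (nat \<times> nat) list \<Rightarrow> (nat \<Rightarrow> nat \<Rightarrow> nat) \<Rightarrow> (nat \<Rightarrow> nat \<Rightarrow> nat) \<Rightarrow> bool" where
  "fRSK_state n w G H \<longleftrightarrow>
     fold (\<lambda>p X. Option.bind X (fRSK_step p)) w (Some (Map.empty, Map.empty)) = Some (filling_of G, filling_of H) \<and>
     fold RSK_step w (Map.empty, Map.empty) = (column_tableau (\<le>) (entries G), column_tableau (\<ge>) (entries H)) \<and>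
     key_skyline (if w = [] then 0 else fst (last w)) G \<and> atom_skyline n H \<and>
     (\<forall>c r. 1 \<le> c \<longrightarrow> (0 < H c r \<longleftrightarrow> 0 < G c r)) \<and>
     (\<forall>c r. 1 \<le> c \<longrightarrow> H c r \<le> (if w = [] then 0 else fst (last w))) \<and>
     (w \<noteq> [] \<longrightarrow> (\<exists>C d. interlaced (\<le>) C \<and>
        inserts 1 (column_tableau (\<le>) C) (snd (last w)) (column_tableau (\<le>) (entries G)) d \<and>
        (\<forall>c r. 1 \<le> c \<longrightarrow> H c r = fst (last w) \<longrightarrow> c \<le> d)))"

lemma fRSK_state_Nil: "fRSK_state n [] (empty_skyline 0) (empty_skyline n)"
  unfolding fRSK_state_def
  using key_skyline_empty[of 0] atom_skyline_empty[of n]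
  by (simp add: filling_of_empty_skyline column_tableau_empty_skyline) (simp add: empty_skyline_def)

lemma fRSK_state_snoc:
  assumes st: "fRSK_state n w G H" and ij: "1 \<le> j" "j \<le> i" "i \<le> n"
    and sorted: "w \<noteq> [] \<Longrightarrow> biword_less (last w) (i, j)"
  shows "\<exists>G' H'. fRSK_state n (w @ [(i, j)]) G' H'"
proof -
  define m where "m = (if w = [] then 0 else fst (last w))"
  have m: "m \<le> i" using sorted by (auto simp: m_def biword_less_def)
  have keyG: "key_skyline m G" and atomH: "atom_skyline n H"
    and supp: "\<And>c r. 1 \<le> c \<Longrightarrow> 0 < H c r \<longleftrightarrow> 0 < G c r"
    and Hle: "\<And>c r. 1 \<le> c \<Longrightarrow> H c r \<le> m"
    using st by (auto simp: fRSK_state_def m_def)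
  \<comment> \<open>The letter is inserted over a basement of \<open>i\<close> cells, whereas the
    previous state has only \<open>m\<close> of them.\<close>
  define G0 where "G0 = G(0 := basement i)"
  have fill0: "filling_of G0 = filling_of G" by (simp add: G0_def filling_of_basement)
  have ct0: "column_tableau R (entries G0) = column_tableau R (entries G)" for R
    by (simp add: G0_def column_tableau_entries_basement)
  have key0: "key_skyline i G0" unfolding G0_def by (rule key_skyline_basement[OF keyG m])
  interpret G0: key_skyline i G0 by (fact key0)
  interpret H: atom_skyline n H by (fact atomH)
  interpret ig: interlaced "(\<le>)" "entries G0" by (rule G0.interlaced_entries)
  have G0_pos: "0 < G0 c r \<longleftrightarrow> 0 < H c r" if "1 \<le> c" for c r
    using supp[OF that] that by (simp add: G0_def)
  obtain G' d p where
    run: "flagged_insert i (filling_of G0) j = Some (filling_of G')" and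
    key': "key_skyline i G'" and grow: "grows G0 G' d p" and
    ins: "inserts 1 (column_tableau (\<le>) (entries G0)) j (column_tableau (\<le>) (entries G')) d"
    using flagged_insert_key_skyline[OF key0 ij(1,2)] by blast
  interpret G': key_skyline i G' by (fact key')
  interpret ig': interlaced "(\<le>)" "entries G'" by (rule G'.interlaced_entries)
  have d: "1 \<le> d" "G0 d p = 0" "0 < G0 (d - 1) p" "0 < G' d p"
    and other: "\<And>e q. (e, q) \<noteq> (d, p) \<Longrightarrow> 0 < G' e q \<longleftrightarrow> 0 < G0 e q"
    and top: "\<And>q. p < q \<Longrightarrow> 0 < G0 (d - 1) q \<Longrightarrow> 0 < G0 d q"
    using grow by (auto simp: grows_def)
  have p: "1 \<le> p" "p \<le> i" using G0.row_range[OF d(3)] by auto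
  \<comment> \<open>For \<open>d = 1\<close> this compares two basements, of sizes \<open>i\<close>
    and \<open>n\<close>, which agree only on the rows up to \<open>i\<close>.\<close>
  have H_left: "0 < H (d - 1) q \<longleftrightarrow> 0 < G0 (d - 1) q" if "1 \<le> q" "q \<le> i" for q
    using G0_pos[of "d - 1" q] that ij d(1) by (cases "d = 1") (auto simp: H.base G0.base basement_def)
  \<comment> \<open>If \<open>i\<close> is already recorded, the last letter also has upper entry
    \<open>i\<close>, so its lower entry is at least \<open>j\<close>. All earlier cells with entry
    \<open>i\<close> are weakly left of its cell, and row bumping puts the new cell strictly to the
    right of it.\<close>
  have Hi: "c < d" if "1 \<le> c" "H c r = i" for c r
  proof -
    have "w \<noteq> []" "m = i" using Hle[OF that(1), of r] that(2) ij m by (auto simp: m_def)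
    then obtain C d' where C: "interlaced (\<le>) C" and
      ins': "inserts 1 (column_tableau (\<le>) C) (snd (last w)) (column_tableau (\<le>) (entries G)) d'" and
      last: "\<And>c r. 1 \<le> c \<Longrightarrow> H c r = fst (last w) \<Longrightarrow> c \<le> d'"
      using st unfolding fRSK_state_def by blast
    have "c \<le> d'" using last[of c r] that \<open>w \<noteq> []\<close> \<open>m = i\<close> by (simp add: m_def)
    interpret ic: interlaced "(\<le>)" C by (fact C)
    have "j \<le> snd (last w)" using sorted \<open>w \<noteq> []\<close> \<open>m = i\<close> by (auto simp: biword_less_def m_def)
    with ins' ins[unfolded ct0] have "d' < d"
    proof (rule row_bumping)
      show "y < x" if "column_tableau (\<le>) C (c, s) = Some x" "column_tableau (\<le>) C (c, Suc s) = Some y"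
        for c s x y
        using ic.column_strict[of s "Suc s" c x y] that by simp
      show "\<exists>x\<ge>y. column_tableau (\<le>) C (c, s) = Some x"
        if "1 \<le> c" "c < e" "column_tableau (\<le>) C (e, s) = Some y" for c e s y
        using ic.row_left[OF that] .
    qed
    then show ?thesis using \<open>c \<le> d'\<close> by simp
  qed
  define H' where "H' = H(d := (H d)(p := i))"
  have Hdp: "H d p = 0" using G0_pos[of d p] d by simp
  have atom': "atom_skyline n H'"
    unfolding H'_def
  proof (rule atom_skyline_add[OF atomH d(1) Hdp _ p(2) ij(3)])
    show "0 < H (d - 1) p" using H_left[of p] p d by simp
    show "H c r \<le> i" if "1 \<le> c" for c r using Hle[OF that, of r] m by simp
    show "c < d" if "1 \<le> c" "H c r = i" for c r using Hi[OF that] .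
    show "0 < H d q" if "p < q" "q \<le> i" "0 < H (d - 1) q" for q
      using H_left[of q] top[of q] G0_pos[of d q] that d p by simp
  qed
  have domS: "diagram (sh (filling_of G')) - diagram (sh (filling_of G)) = {(d, p)}"
  proof -
    have "dom (filling_of G') - dom (filling_of G0) = {(d, p)}"
    proof (rule set_eqI)
      fix u :: cell
      obtain e q where u: "u = (e, q)" by (cases u)
      show "u \<in> dom (filling_of G') - dom (filling_of G0) \<longleftrightarrow> u \<in> {(d, p)}"
        unfolding u Diff_iff mem_dom_filling_of using other[of e q] d by (cases "(e, q) = (d, p)") auto
    qed
    then show ?thesis using G'.dom_filling_of G0.dom_filling_of fill0 by simp
  qed
  have fillH: "filling_of H' = (filling_of H)((d, p) \<mapsto> i)"
    unfolding H'_def by (rule filling_of_upd) (use d ij in auto)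
  have step1: "fRSK_step (i, j) (filling_of G, filling_of H) = Some (filling_of G', filling_of H')"
    using run fill0 domS fillH by (simp add: Let_def)
  have cardG: "card (entries G0 d) = card (entries H d)"
    unfolding G0.card_entries H.card_entries using G0_pos[OF d(1)] by simp
  have card': "card (entries G' e) = (if e = d then Suc (card (entries G0 e)) else card (entries G0 e))" for e
  proof -
    have "{r. 0 < G' e r} = (if e = d then insert p {r. 0 < G0 e r} else {r. 0 < G0 e r})"
    proof (rule set_eqI)
      fix q
      show "q \<in> {r. 0 < G' e r} \<longleftrightarrow> q \<in> (if e = d then insert p {r. 0 < G0 e r} else {r. 0 < G0 e r})"
        using other[of e q] d by (cases "(e, q) = (d, p)") auto
    qed
    then show ?thesis unfolding G0.card_entries G'.card_entries using d G0.finite_rows[of d] by auto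
  qed
  \<comment> \<open>RSK puts its new cell on top of column \<open>d\<close>, in general not in row
    \<open>p\<close>. Only the column matters for agreement, since both recording fillings add
    \<open>i\<close> to the set of column \<open>d\<close>.\<close>
  have domP: "dom (column_tableau (\<le>) (entries G')) - dom (column_tableau (\<le>) (entries G)) =
      {(d, Suc (card (entries H d)))}"
  proof (rule set_eqI)
    fix u :: cell
    obtain e q where u: "u = (e, q)" by (cases u)
    show "u \<in> dom (column_tableau (\<le>) (entries G')) - dom (column_tableau (\<le>) (entries G)) \<longleftrightarrow>
        u \<in> {(d, Suc (card (entries H d)))}"
      unfolding u Diff_iff ct0[symmetric] decreasing.mem_dom_column_tableau[OF G0.finite_entries]
        decreasing.mem_dom_column_tableau[OF G'.finite_entries] card'
      using d cardG by auto
  qed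
  have entH: "entries H' = (entries H)(d := insert i (entries H d))"
  proof -
    have "entries H d - {0} = entries H d" by (auto simp: entries_def)
    moreover have "H d q \<noteq> i" for q using Hi[of d q] d by auto
    ultimately show ?thesis unfolding H'_def using H.entries_upd[of i d p] Hdp ij by simp
  qed
  have Q': "column_tableau (\<ge>) (entries H') =
      (column_tableau (\<ge>) (entries H))((d, Suc (card (entries H d))) \<mapsto> i)"
    unfolding entH
  proof (rule increasing.column_tableau_insert[OF H.finite_entries d(1)])
    fix x assume "x \<in> entries H d"
    then obtain q where "x = H d q" by (auto simp: entries_def)
    then show "\<not> i \<le> x" using Hle[OF d(1), of q] Hi[OF d(1), of q] m by auto
  qed
  have "row_insert (column_tableau (\<le>) (entries G)) j = column_tableau (\<le>) (entries G')"
    unfolding row_insert_def using row_insert_from_inserts[OF ins] ct0 by simp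
  then have step2: "RSK_step (i, j) (column_tableau (\<le>) (entries G), column_tableau (\<ge>) (entries H)) =
      (column_tableau (\<le>) (entries G'), column_tableau (\<ge>) (entries H'))"
    using domP Q' by (simp add: Let_def)
  have "fRSK_state n (w @ [(i, j)]) G' H'"
    unfolding fRSK_state_def
  proof (intro conjI allI impI)
    show "fold (\<lambda>p X. Option.bind X (fRSK_step p)) (w @ [(i, j)]) (Some (Map.empty, Map.empty)) =
        Some (filling_of G', filling_of H')"
      using st step1 by (simp add: fRSK_state_def)
    show "fold RSK_step (w @ [(i, j)]) (Map.empty, Map.empty) =
        (column_tableau (\<le>) (entries G'), column_tableau (\<ge>) (entries H'))"
      using st step2 by (simp add: fRSK_state_def)
    show "0 < H' c r \<longleftrightarrow> 0 < G' c r" if "1 \<le> c" for c r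
      using other[of c r] G0_pos[OF that, of r] d ij by (auto simp: H'_def)
    show "H' c r \<le> (if w @ [(i, j)] = [] then 0 else fst (last (w @ [(i, j)])))" if "1 \<le> c" for c r
      using Hle[OF that, of r] m by (auto simp: H'_def)
    \<comment> \<open>The tableau before this letter, given by \<open>entries G0\<close>, is the
      witness kept for the comparison with the next letter.\<close>
    have "c \<le> d" if "1 \<le> c" "H' c r = i" for c r
      using Hi[of c r] that by (auto simp: H'_def split: if_splits)
    then show "\<exists>C d. interlaced (\<le>) C \<and> inserts 1 (column_tableau (\<le>) C) (snd (last (w @ [(i, j)])))
          (column_tableau (\<le>) (entries G')) d \<and>
        (\<forall>c r. 1 \<le> c \<longrightarrow> H' c r = fst (last (w @ [(i, j)])) \<longrightarrow> c \<le> d)"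
      using ins ig.interlaced_axioms by (intro exI[of _ "entries G0"] exI[of _ d]) auto
  qed (use key' atom' in auto)
  then show ?thesis by blast
qed

lemma fRSK_state_exists:
  assumes "sorted_wrt biword_less w" "\<And>i j. (i, j) \<in> set w \<Longrightarrow> 1 \<le> j \<and> j \<le> i \<and> i \<le> n"
  shows "\<exists>G H. fRSK_state n w G H"
  using assms
proof (induction w rule: rev_induct)
  case Nil
  then show ?case using fRSK_state_Nil by blast
next
  case (snoc x w)
  obtain i j where x: "x = (i, j)" by (cases x)
  have w: "sorted_wrt biword_less w" "\<And>y. y \<in> set w \<Longrightarrow> biword_less y (i, j)"
    using snoc.prems(1) by (auto simp: x sorted_wrt_append)
  obtain G H where "fRSK_state n w G H" using snoc.IH[OF w(1)] snoc.prems(2) by auto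
  then show ?case unfolding x
  proof (rule fRSK_state_snoc)
    show "1 \<le> j" "j \<le> i" "i \<le> n" using snoc.prems(2)[of i j] x by auto
    show "biword_less (last w) (i, j)" if "w \<noteq> []" using w(2) that by simp
  qed
qed

theorem theorem5p10:
  fixes n :: nat and L :: "nat \<Rightarrow> nat \<Rightarrow> nat"
  assumes "1 \<le> n"
    and "L \<in> lower_matrices n"
  shows "\<exists>S T. fRSK n L = Some (S, T) \<and> (S, T) \<in> FP n \<and> (\<tau> n S, \<rho> n T) = RSK n L"
proof -
  let ?w = "biword n L"
  obtain G H where st: "fRSK_state n ?w G H"
    using fRSK_state_exists[OF sorted_biword] set_biword_lower[OF assms(2)] by blast
  define m where "m = (if ?w = [] then 0 else fst (last ?w))"
  have m: "m \<le> n"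
    using set_biword_lower[OF assms(2), of m "snd (last ?w)"] last_in_set[of ?w] by (auto simp: m_def)
  have keyG: "key_skyline m G" and atomH: "atom_skyline n H"
    and supp: "\<And>c r. 1 \<le> c \<Longrightarrow> 0 < H c r \<longleftrightarrow> 0 < G c r"
    using st by (auto simp: fRSK_state_def m_def)
  interpret G: key_skyline m G by (fact keyG)
  interpret H: atom_skyline n H by (fact atomH)
  \<comment> \<open>The final basement has size \<open>m\<close>, the last upper letter, and is
    extended to \<open>n\<close> only here.\<close>
  have "filling_of G \<in> SSKT n"
    using key_skyline.SSKT[OF key_skyline_basement[OF keyG m]] by (simp add: filling_of_basement)
  moreover have "sh (filling_of G) = sh (filling_of H)"
    unfolding sh_def fun_eq_iff mem_dom_filling_of using supp by (intro allI arg_cong[of _ _ card]) auto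
  ultimately have "(filling_of G, filling_of H) \<in> FP n" using H.rSSAF by (simp add: FP_def)
  moreover have "fRSK n L = Some (filling_of G, filling_of H)"
    and "RSK n L = (column_tableau (\<le>) (entries G), column_tableau (\<ge>) (entries H))"
    using st by (simp_all add: fRSK_def RSK_def fRSK_state_def)
  moreover have "\<tau> n (filling_of G) = column_tableau (\<le>) (entries G)"
  proof (rule \<tau>_eq[OF G.interlaced_entries])
    show "entries G c \<subseteq> {1..n}" for c using G.entries_range[of c] m by fastforce
  qed (simp add: G.column_set_filling_of entries_def)
  moreover have "\<rho> n (filling_of H) = column_tableau (\<ge>) (entries H)"
    by (rule \<rho>_eq[OF H.interlaced_entries H.entries_range])
      (simp add: H.column_set_filling_of entries_def)
  ultimately show ?thesis by simp
qed

end
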